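(* Let $\mathbf G$ be an indexing category and fix an admissible function $\phi>0$. Write $P=\mathrm{Prob}\langle\mathbf G\rangle$. Consider the maps of pseudo-metric spaces $$f:(P,\kappa)\to(\mathrm{L}(P,\mathbf k),\hat{\mathbf k}),\qquad f':(P,\kappa)\to(\mathrm{L}(P,\kappa),\hat\kappa),\qquad \mathcal X\mapsto\{\mathcal X^{i}\}_{i\in\mathbb{N}_0},$$ and the natural inclusions $$\imath_1:(\mathrm{L}(P,\mathbf k),\hat{\mathbf k})\hookrightarrow(\mathrm{L}(P,\kappa),\hat\kappa),\qquad \imath_2:(\mathrm{QL}_\phi(P,\mathbf k),\hat{\mathbf k})\hookrightarrow(\mathrm{QL}_\phi(P,\kappa),\hat\kappa),$$ $$\jmath_1:(\mathrm{L}(P,\mathbf k),\hat{\mathbf k})\hookrightarrow(\mathrm{QL}_\phi(P,\mathbf k),\hat{\mathbf k}),\qquad \jmath_2:(\mathrm{L}(P,\kappa),\hat\kappa)\hookrightarrow(\mathrm{QL}_\phi(P,\kappa),\hat\kappa),$$ which satisfy $\imath_1\circ f=f'$ and $\imath_2\circ\jmath_1=\jmath_2\circ\imath_1$. Then: (1) The maps $f,f',\imath_1$ are isometries. (2) The maps $\imath_2,\jmath_1,\jmath_2$ are isometric embeddings and each has a dense image in the corresponding target space. (3) The space $(\mathrm{QL}_\phi(P,\kappa),\hat\kappa)$ is complete.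
   Context: $\mathbb{N}=\{1,2,\dots\}$, $\mathbb{N}_0=\mathbb{N}\cup\{0\}$. A pseudo-metric may vanish on pairs of distinct points. An isometric embedding of pseudo-metric spaces is a distance-preserving map; an isometry is a distance-preserving map such that every point of the target is at distance zero from some point of the image. Complete means every Cauchy sequence converges. Diagrams. A finite probability space is a set with a probability measure of finite support; its atoms are the points of positive weight, and $\mathrm{Ent}(X)=-\sum_{x}p(x)\ln p(x)$. A reduction is an equivalence class of measure-preserving maps, where maps agreeing on a set of full measure are identified. An indexing category $\mathbf G$ is a finite category with at most one morphism between any two objects in either direction (equivalently a finite poset) such that every pair of objects $i,j$ has a least common ancestor: an object $k$ with morphisms $k\to i$, $k\to j$ such that any object $l$ with morphisms $l\to i$, $l\to j$ has a morphism $l\to k$. $\mathrm{Prob}\langle\mathbf G\rangle$ is the space of $\mathbf G$-diagrams, i.e. commutative diagrams (functors) of shape $\mathbf G$ of finite probability spaces and reductions; a morphism of $\mathbf G$-diagrams is a collection of reductions between corresponding spaces commuting with the reductions within the diagrams. The tensor product $\mathcal X\otimes\mathcal Y$ takes products of corresponding probability spaces and Cartesian products of maps; its neutral element is the constant diagram of one-point spaces (isomorphic diagrams are regarded as the same), and $\mathcal X^n$ is the $n$-fold tensor power. $\mathrm{Ent}_*(\mathcal X)\in\mathbb{R}^{\mathbf G}$ is the vector of entropies of the individual spaces; $\mathbb{R}^{\mathbf G}$ (real functions on objects of $\mathbf G$) carries the $\ell^1$-norm $\|\cdot\|_1$. Distances. For a two-fan $\mathcal F=(\mathcal X\leftarrow\mathcal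 Z\to\mathcal Y)$ of $\mathbf G$-diagrams (two morphisms of diagrams with common source), $\mathrm{kd}(\mathcal F)=\|\mathrm{Ent}_*\mathcal Z-\mathrm{Ent}_*\mathcal X\|_1+\|\mathrm{Ent}_*\mathcal Z-\mathrm{Ent}_*\mathcal Y\|_1$. The intrinsic entropy distance is $\mathbf{k}(\mathcal X,\mathcal Y)=\inf\{\mathrm{kd}(\mathcal F)\}$ over all two-fans $\mathcal F=(\mathcal X\leftarrow\mathcal Z\to\mathcal Y)$, and the asymptotic entropy distance is $\kappa(\mathcal X,\mathcal Y)=\lim_{n\to\infty}\frac1n\mathbf{k}(\mathcal X^{n},\mathcal Y^{n})$. Both are pseudo-distances for which $\otimes$ is $1$-Lipschitz in each argument, and $\kappa\le\mathbf k$. Quasi-linear sequences. A function $\phi:\mathbb{R}_{\ge1}\to\mathbb{R}_{\ge0}$ is admissible if it is non-decreasing and there is a constant $D_\phi\ge0$ such that $s\int_s^\infty \frac{\phi(t)}{t^2}\,dt\le\frac{D_\phi}{8}\phi(s)$ for all $s\ge1$. For $\rho\in\{\mathbf k,\kappa\}$, a sequence $\bar{\mathcal X}=\{\mathcal X(i)\}_{i\in\mathbb{N}_0}$ in $P$ is $\rho$-quasi-linear with defect bounded by $\phi$ if $\mathcal X(0)$ is the neutral element and $\rho(\mathcal X(m+n),\mathcal X(m)\otimes\mathcal X(n))\le\phi(m+n)$ for all $m,n\in\mathbb{N}$. $\mathrm{QL}_\phi(P,\rho)$ is the set of sequences that are $\rho$-quasi-linear with defect bounded by $C\phi$ for some $C\ge0$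 depending on the sequence, and $\mathrm{L}(P,\rho)=\mathrm{QL}_0(P,\rho)$ is the set of linear sequences. The asymptotic distance is $\hat\rho(\bar{\mathcal X},\bar{\mathcal Y})=\lim_{n\to\infty}\frac1n\rho(\mathcal X(n),\mathcal Y(n))$ (the limit exists and is finite), a pseudo-distance. *)

theory Defs
  imports "HOL-Probability.Probability"
begin

section \<open>Finite probability spaces and reductions\<close>

text \<open>
  Only the atoms of a finite probability space matter up to isomorphism, and there are finitely
  many of them, so all spaces are realised on the underlying set \<open>nat\<close>. Cartesian products are
  brought back to \<open>nat\<close> by the bijection \<open>prod_encode\<close>.
\<close>

definition finite_prob_space :: "nat pmf \<Rightarrow> bool" where
  "finite_prob_space p \<longleftrightarrow> finite (set_pmf p)"

definition Ent :: "nat pmf \<Rightarrow> real" where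
  "Ent p = - (\<Sum>x\<in>set_pmf p. pmf p x * ln (pmf p x))"

text \<open>
  A reduction is an equivalence class of measure-preserving maps modulo equality on a set of full
  measure. It is given here by a representative, and equality of reductions out of \<open>p\<close> is
  \<open>red_eq p\<close>.
\<close>

definition reduction :: "nat pmf \<Rightarrow> nat pmf \<Rightarrow> (nat \<Rightarrow> nat) \<Rightarrow> bool" where
  "reduction p q f \<longleftrightarrow> map_pmf f p = q"

definition red_eq :: "nat pmf \<Rightarrow> (nat \<Rightarrow> nat) \<Rightarrow> (nat \<Rightarrow> nat) \<Rightarrow> bool" where
  "red_eq p f g \<longleftrightarrow> (AE x in measure_pmf p. f x = g x)"

section \<open>Indexing categories and diagrams\<close>

text \<open>
  An indexing category is given by its set \<open>G\<close> of arrows: \<open>(i, j) \<in> G\<close> iff there is a (then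
  unique) morphism from \<open>i\<close> to \<open>j\<close>. Since \<open>G\<close> is reflexive, \<open>Field G\<close> is the set of objects.
\<close>

definition indexing_category :: "('g \<times> 'g) set \<Rightarrow> bool" where
  "indexing_category G \<longleftrightarrow>
     finite (Field G) \<and> Partial_order G \<and>
     (\<forall>i\<in>Field G. \<forall>j\<in>Field G. \<exists>k\<in>Field G.
        (k, i) \<in> G \<and> (k, j) \<in> G \<and>
        (\<forall>l\<in>Field G. (l, i) \<in> G \<and> (l, j) \<in> G \<longrightarrow> (l, k) \<in> G))"

text \<open>The values of \<open>space_at\<close> off \<open>Field G\<close> and of \<open>red_at\<close> off \<open>G\<close> are irrelevant.\<close>

record 'g diagram =
  space_at :: "'g \<Rightarrow> nat pmf"
  red_at :: "'g \<Rightarrow> 'g \<Rightarrow> nat \<Rightarrow> nat"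

definition Prob :: "('g \<times> 'g) set \<Rightarrow> 'g diagram set" where
  "Prob G = {X.
     (\<forall>i\<in>Field G. finite_prob_space (space_at X i)) \<and>
     (\<forall>(i, j)\<in>G. reduction (space_at X i) (space_at X j) (red_at X i j)) \<and>
     (\<forall>i\<in>Field G. red_eq (space_at X i) (red_at X i i) id) \<and>
     (\<forall>i j k. (i, j) \<in> G \<and> (j, k) \<in> G \<longrightarrow>
        red_eq (space_at X i) (red_at X j k \<circ> red_at X i j) (red_at X i k))}"

definition diagram_morphism ::
  "('g \<times> 'g) set \<Rightarrow> 'g diagram \<Rightarrow> 'g diagram \<Rightarrow> ('g \<Rightarrow> nat \<Rightarrow> nat) \<Rightarrow> bool" where
  "diagram_morphism G X Y a \<longleftrightarrow>
     (\<forall>i\<in>Field G. reduction (space_at X i) (space_at Y i) (a i)) \<and>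
     (\<forall>(i, j)\<in>G. red_eq (space_at X i) (red_at Y i j \<circ> a i) (a j \<circ> red_at X i j))"

definition diagram_iso :: "('g \<times> 'g) set \<Rightarrow> 'g diagram \<Rightarrow> 'g diagram \<Rightarrow> bool" where
  "diagram_iso G X Y \<longleftrightarrow>
     (\<exists>a b. diagram_morphism G X Y a \<and> diagram_morphism G Y X b \<and>
        (\<forall>i\<in>Field G. red_eq (space_at X i) (b i \<circ> a i) id \<and> red_eq (space_at Y i) (a i \<circ> b i) id))"

definition tensor :: "'g diagram \<Rightarrow> 'g diagram \<Rightarrow> 'g diagram" where
  "tensor X Y = \<lparr>
     space_at = (\<lambda>i. map_pmf prod_encode (pair_pmf (space_at X i) (space_at Y i))),
     red_at = (\<lambda>i j z. prod_encode (map_prod (red_at X i j) (red_at Y i j) (prod_decode z))) \<rparr>"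

definition unit_diagram :: "'g diagram" where
  "unit_diagram = \<lparr> space_at = (\<lambda>i. return_pmf 0), red_at = (\<lambda>i j. id) \<rparr>"

fun tensor_power :: "'g diagram \<Rightarrow> nat \<Rightarrow> 'g diagram" where
  "tensor_power X 0 = unit_diagram"
| "tensor_power X (Suc n) = tensor X (tensor_power X n)"

section \<open>Entropy distances\<close>

definition ent_vec :: "'g diagram \<Rightarrow> 'g \<Rightarrow> real" where
  "ent_vec X i = Ent (space_at X i)"

definition l1_norm :: "('g \<times> 'g) set \<Rightarrow> ('g \<Rightarrow> real) \<Rightarrow> real" where
  "l1_norm G v = (\<Sum>i\<in>Field G. \<bar>v i\<bar>)"

text \<open>\<open>two_fan G X Z Y a b\<close>: the morphisms \<open>a\<close> and \<open>b\<close> form a two-fan \<open>X \<leftarrow> Z \<rightarrow> Y\<close>.\<close>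

definition two_fan :: "('g \<times> 'g) set \<Rightarrow> 'g diagram \<Rightarrow> 'g diagram \<Rightarrow> 'g diagram \<Rightarrow>
    ('g \<Rightarrow> nat \<Rightarrow> nat) \<Rightarrow> ('g \<Rightarrow> nat \<Rightarrow> nat) \<Rightarrow> bool" where
  "two_fan G X Z Y a b \<longleftrightarrow> Z \<in> Prob G \<and> diagram_morphism G Z X a \<and> diagram_morphism G Z Y b"

definition kd :: "('g \<times> 'g) set \<Rightarrow> 'g diagram \<Rightarrow> 'g diagram \<Rightarrow> 'g diagram \<Rightarrow> real" where
  "kd G X Z Y = l1_norm G (\<lambda>i. ent_vec Z i - ent_vec X i) + l1_norm G (\<lambda>i. ent_vec Z i - ent_vec Y i)"

definition kdist :: "('g \<times> 'g) set \<Rightarrow> 'g diagram \<Rightarrow> 'g diagram \<Rightarrow> real" where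
  "kdist G X Y = Inf {kd G X Z Y | Z a b. two_fan G X Z Y a b}"

definition kappa :: "('g \<times> 'g) set \<Rightarrow> 'g diagram \<Rightarrow> 'g diagram \<Rightarrow> real" where
  "kappa G X Y = lim (\<lambda>n. kdist G (tensor_power X n) (tensor_power Y n) / real n)"

section \<open>Quasi-linear sequences\<close>

text \<open>Functions on \<open>[1, \<infinity>)\<close> are functions on \<open>real\<close> whose values below \<open>1\<close> are irrelevant.\<close>

definition admissible :: "(real \<Rightarrow> real) \<Rightarrow> bool" where
  "admissible \<phi> \<longleftrightarrow>
     (\<forall>t\<ge>1. 0 \<le> \<phi> t) \<and> mono_on {1..} \<phi> \<and>
     (\<exists>D\<ge>0. \<forall>s\<ge>1.
        set_integrable lborel {s..} (\<lambda>t. \<phi> t / t\<^sup>2) \<and>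
        s * (LINT t:{s..}|lborel. \<phi> t / t\<^sup>2) \<le> D / 8 * \<phi> s)"

text \<open>Isomorphic diagrams are regarded as the same, hence \<open>diagram_iso\<close> at index \<open>0\<close>.\<close>

definition quasi_linear :: "('g \<times> 'g) set \<Rightarrow> ('g diagram \<Rightarrow> 'g diagram \<Rightarrow> real) \<Rightarrow>
    (real \<Rightarrow> real) \<Rightarrow> (nat \<Rightarrow> 'g diagram) \<Rightarrow> bool" where
  "quasi_linear G \<rho> \<phi> X \<longleftrightarrow>
     (\<forall>i. X i \<in> Prob G) \<and> diagram_iso G (X 0) unit_diagram \<and>
     (\<forall>m\<ge>1. \<forall>n\<ge>1. \<rho> (X (m + n)) (tensor (X m) (X n)) \<le> \<phi> (real (m + n)))"

definition QL :: "('g \<times> 'g) set \<Rightarrow> ('g diagram \<Rightarrow> 'g diagram \<Rightarrow> real) \<Rightarrow> (real \<Rightarrow> real) \<Rightarrow>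
    (nat \<Rightarrow> 'g diagram) set" where
  "QL G \<rho> \<phi> = {X. \<exists>C\<ge>0. quasi_linear G \<rho> (\<lambda>t. C * \<phi> t) X}"

definition Lin :: "('g \<times> 'g) set \<Rightarrow> ('g diagram \<Rightarrow> 'g diagram \<Rightarrow> real) \<Rightarrow>
    (nat \<Rightarrow> 'g diagram) set" where
  "Lin G \<rho> = QL G \<rho> (\<lambda>_. 0)"

definition asymp_dist :: "('g diagram \<Rightarrow> 'g diagram \<Rightarrow> real) \<Rightarrow>
    (nat \<Rightarrow> 'g diagram) \<Rightarrow> (nat \<Rightarrow> 'g diagram) \<Rightarrow> real" where
  "asymp_dist \<rho> X Y = lim (\<lambda>n. \<rho> (X n) (Y n) / real n)"

section \<open>Pseudo-metric spaces\<close>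

text \<open>
  The library's \<open>Metric_space\<close> demands that distinct points have positive distance, so the
  pseudo-metric versions are spelled out. The predicates on maps include that both sides are
  pseudo-metric spaces and that the map is well defined.
\<close>

definition pseudo_metric_space :: "'a set \<Rightarrow> ('a \<Rightarrow> 'a \<Rightarrow> real) \<Rightarrow> bool" where
  "pseudo_metric_space M d \<longleftrightarrow>
     (\<forall>x\<in>M. \<forall>y\<in>M. 0 \<le> d x y) \<and>
     (\<forall>x\<in>M. d x x = 0) \<and>
     (\<forall>x\<in>M. \<forall>y\<in>M. d x y = d y x) \<and>
     (\<forall>x\<in>M. \<forall>y\<in>M. \<forall>z\<in>M. d x z \<le> d x y + d y z)"

definition isometric_embedding ::
  "'a set \<Rightarrow> ('a \<Rightarrow> 'a \<Rightarrow> real) \<Rightarrow> 'b set \<Rightarrow> ('b \<Rightarrow> 'b \<Rightarrow> real) \<Rightarrow> ('a \<Rightarrow> 'b) \<Rightarrow> bool" where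
  "isometric_embedding M d N e f \<longleftrightarrow>
     pseudo_metric_space M d \<and> pseudo_metric_space N e \<and>
     f \<in> M \<rightarrow> N \<and> (\<forall>x\<in>M. \<forall>y\<in>M. e (f x) (f y) = d x y)"

definition isometry ::
  "'a set \<Rightarrow> ('a \<Rightarrow> 'a \<Rightarrow> real) \<Rightarrow> 'b set \<Rightarrow> ('b \<Rightarrow> 'b \<Rightarrow> real) \<Rightarrow> ('a \<Rightarrow> 'b) \<Rightarrow> bool" where
  "isometry M d N e f \<longleftrightarrow>
     isometric_embedding M d N e f \<and> (\<forall>y\<in>N. \<exists>x\<in>M. e (f x) y = 0)"

definition dense_image ::
  "'a set \<Rightarrow> 'b set \<Rightarrow> ('b \<Rightarrow> 'b \<Rightarrow> real) \<Rightarrow> ('a \<Rightarrow> 'b) \<Rightarrow> bool" where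
  "dense_image M N e f \<longleftrightarrow> (\<forall>y\<in>N. \<forall>\<epsilon>>0. \<exists>x\<in>M. e (f x) y < \<epsilon>)"

definition complete_pseudo_metric :: "'a set \<Rightarrow> ('a \<Rightarrow> 'a \<Rightarrow> real) \<Rightarrow> bool" where
  "complete_pseudo_metric M d \<longleftrightarrow>
     pseudo_metric_space M d \<and>
     (\<forall>\<sigma> :: nat \<Rightarrow> 'a.
        (\<forall>n. \<sigma> n \<in> M) \<and> (\<forall>\<epsilon>>0. \<exists>K. \<forall>m\<ge>K. \<forall>n\<ge>K. d (\<sigma> m) (\<sigma> n) < \<epsilon>) \<longrightarrow>
        (\<exists>x\<in>M. (\<lambda>n. d (\<sigma> n) x) \<longlonglongrightarrow> 0))"

section \<open>The maps\<close>

definition power_seq :: "'g diagram \<Rightarrow> nat \<Rightarrow> 'g diagram" where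
  "power_seq X = (\<lambda>i. tensor_power X i)"

definition inclusion :: "(nat \<Rightarrow> 'g diagram) \<Rightarrow> nat \<Rightarrow> 'g diagram" where
  "inclusion X = X"

end

theory Submission
  imports Defs
begin

text \<open>
  Everything except density is formal in a commutative monoid with a translation-compatible
  pseudo-metric: the limits exist by almost subadditivity (Fekete, de Bruijn--Erdos), and along
  multiples of \<open>m\<close> a quasi-linear sequence stays within \<open>O(n \<phi>(m))\<close> of the powers of \<open>X(m)\<close>,
  where \<open>\<phi>(m) / m\<close> tends to \<open>0\<close>. This makes the two asymptotic distances agree and reduces density
  to finding approximate \<open>m\<close>-th roots. Such a root of a diagram \<open>X\<close> is the mixture of \<open>X\<close> with weight
  \<open>1/m\<close> and the one-point diagram: its \<open>n\<close>-th power is a mixture of powers of \<open>X\<close> with binomially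
  distributed exponent, and forgetting the mixing variable costs only \<open>O(ln m)\<close> asymptotically.
  A Cauchy sequence can then be taken to consist of powers \<open>z(i)\<^sup>n\<close>, and its limit is \<open>z(I(n))\<^sup>n\<close>
  for a sufficiently fast growing \<open>I\<close>.

  The triangle inequality for the intrinsic distance couples two diagrams at the initial object of
  the indexing category and uses submodularity of entropy at every object.
\<close>

text \<open>All density claims come from one statement: powers of single diagrams are dense in the
  largest space, that of the \<kappa>-quasi-linear sequences. Powers are the bridge because a
  \<kappa>-quasi-linear sequence carries no evident defect bound for the intrinsic distance, whereas
  a power sequence is linear for both distances and so lies in all the sequence spaces at once.

  The weight \<open>1/m\<close> of the approximate root is chosen so that the \<open>m\<close>-th
  power contains one copy of \<open>X\<close> on average. After \<open>K\<close> further powers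
  there are about \<open>K\<close> copies, with a deviation of order \<open>sqrt K\<close> that
  disappears on dividing by \<open>K\<close>. What stays is the entropy of \<open>m\<close> mixing
  variables, at most \<open>1 + ln m\<close> for each object. Like \<phi>(m) it is negligible
  against \<open>m\<close>, so a root of \<open>X(m)\<close> gives a good approximation of the whole
  sequence.

  The asymptotic distance satisfies the same monoid axioms as the intrinsic one. The abstract
  results are therefore used twice, once for each distance.\<close>

section \<open>Almost subadditive sequences\<close>

text \<open>This is what remains of admissibility after cutting the integral into dyadic blocks.\<close>

definition dyadic_admissible :: "(nat \<Rightarrow> real) \<Rightarrow> real \<Rightarrow> bool" where
  "dyadic_admissible \<phi> D \<longleftrightarrow>
     (\<forall>n\<ge>1. 0 \<le> \<phi> n) \<and> (\<forall>m n. 1 \<le> m \<and> m \<le> n \<longrightarrow> \<phi> m \<le> \<phi> n) \<and> 0 \<le> D \<and>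
     (\<forall>m\<ge>1. \<forall>k. (\<Sum>i=1..k. \<phi> (2 ^ i * m) / 2 ^ i) \<le> D * \<phi> m)"

definition almost_subadditive :: "(nat \<Rightarrow> real) \<Rightarrow> (nat \<Rightarrow> real) \<Rightarrow> bool" where
  "almost_subadditive \<phi> a \<longleftrightarrow> (\<forall>p\<ge>1. \<forall>q\<ge>1. a (p + q) \<le> a p + a q + \<phi> (p + q))"

lemma dyadic_admissibleD:
  assumes "dyadic_admissible \<phi> D"
  shows "1 \<le> n \<Longrightarrow> 0 \<le> \<phi> n" "1 \<le> m \<Longrightarrow> m \<le> n \<Longrightarrow> \<phi> m \<le> \<phi> n" "0 \<le> D"
    "1 \<le> m \<Longrightarrow> (\<Sum>i=1..k. \<phi> (2 ^ i * m) / 2 ^ i) \<le> D * \<phi> m"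
  using assms unfolding dyadic_admissible_def by blast+

lemma dyadic_admissible_zero: "dyadic_admissible (\<lambda>_. 0) 0"
  by (simp add: dyadic_admissible_def)

lemma dyadic_admissible_scale:
  assumes "dyadic_admissible \<phi> D" "0 \<le> C"
  shows "dyadic_admissible (\<lambda>n. C * \<phi> n) D"
proof -
  have "(\<Sum>i=1..k. C * \<phi> (2 ^ i * m) / 2 ^ i) \<le> D * (C * \<phi> m)" if "1 \<le> m" for m k
    using mult_left_mono[OF dyadic_admissibleD(4)[OF assms(1) that, of k] assms(2)]
    by (simp add: sum_distrib_left mult_ac)
  then show ?thesis
    using assms dyadic_admissibleD[OF assms(1)] unfolding dyadic_admissible_def
    by (auto intro: mult_left_mono)
qed

text \<open>Serves to sample a sequence at the multiples of \<open>m\<close>: the dyadic sums of the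
  dilated function are those of \<phi> started at a multiple of \<open>m\<close>, so the constant
  \<open>D\<close> is kept.\<close>

lemma dyadic_admissible_dilate:
  assumes "dyadic_admissible \<phi> D" "1 \<le> m"
  shows "dyadic_admissible (\<lambda>n. \<phi> (n * m)) D"
proof -
  have pos: "1 \<le> n * m" if "1 \<le> n" for n using that \<open>1 \<le> m\<close> by simp
  note adm = dyadic_admissibleD[OF assms(1)]
  show ?thesis
    unfolding dyadic_admissible_def
  proof (intro conjI allI impI)
    show "\<phi> (i * m) \<le> \<phi> (j * m)" if "1 \<le> i \<and> i \<le> j" for i j
      using that pos by (intro adm(2)) auto
    show "(\<Sum>i=1..k. \<phi> (2 ^ i * n * m) / 2 ^ i) \<le> D * \<phi> (n * m)" if "1 \<le> n" for n k
      using adm(4)[OF pos[OF that], of k] by (simp add: mult.assoc)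
  qed (use adm(1,3) pos in auto)
qed

lemma dyadic_bracket:
  fixes n :: nat
  assumes "1 \<le> n"
  obtains k where "n \<le> 2 ^ k" "2 ^ k < 2 * n"
proof -
  define k where "k = (LEAST k. n \<le> 2 ^ k)"
  have 1: "n \<le> 2 ^ k"
    unfolding k_def by (rule LeastI[of _ n]) (simp add: less_imp_le)
  have "2 ^ k < 2 * n"
  proof (cases k)
    case 0
    then show ?thesis using assms by simp
  next
    case (Suc j)
    then have "\<not> n \<le> 2 ^ j"
      using not_less_Least[of j "\<lambda>k. n \<le> 2 ^ k"] by (simp add: k_def)
    then show ?thesis using Suc by simp
  qed
  then show ?thesis using 1 that by blast
qed

text \<open>The case \<open>m = 1\<close> bounds the partial sums of \<phi>(2^i) / 2^i, whose terms
  therefore tend to 0. Monotonicity carries this to all \<open>n\<close> through a power of two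
  below \<open>2 * n\<close>; the factor 2 is absorbed by \<open>e / 2\<close>.\<close>

lemma dyadic_admissible_sublinear:
  assumes "dyadic_admissible \<phi> D"
  shows "(\<lambda>n. \<phi> n / real n) \<longlonglongrightarrow> 0"
proof -
  note adm = dyadic_admissibleD[OF assms]
  let ?t = "\<lambda>i. \<phi> (2 ^ i) / 2 ^ i"
  have "summable (\<lambda>i. ?t (Suc i))"
  proof (rule summableI_nonneg_bounded)
    show "0 \<le> ?t (Suc i)" for i
      using adm(1)[of "2 ^ Suc i"] by (simp add: divide_nonneg_pos)
    show "(\<Sum>i<n. ?t (Suc i)) \<le> D * \<phi> 1" for n
      using adm(4)[of 1 n] by (simp add: sum.atLeast1_atMost_eq lessThan_Suc_atMost)
  qed
  then have "(\<lambda>i. ?t (Suc i)) \<longlonglongrightarrow> 0"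
    by (rule summable_LIMSEQ_zero)
  then have t0: "?t \<longlonglongrightarrow> 0"
    by (rule LIMSEQ_imp_Suc)
  show ?thesis
  proof (rule LIMSEQ_I)
    fix e :: real assume "0 < e"
    from LIMSEQ_D[OF t0, of "e / 2"] \<open>0 < e\<close> obtain N where N: "\<And>i. i \<ge> N \<Longrightarrow> norm (?t i) < e / 2"
      by auto
    show "\<exists>M. \<forall>n\<ge>M. norm (\<phi> n / real n - 0) < e"
    proof (intro exI[of _ "2 ^ N + 1"] allI impI)
      fix n :: nat assume n: "2 ^ N + 1 \<le> n"
      then have n1: "1 \<le> n" by linarith
      obtain k where k: "n \<le> 2 ^ k" "2 ^ k < 2 * n"
        using dyadic_bracket[OF n1] by blast
      have "(2::nat) ^ N < 2 ^ k" using n k by linarith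
      then have "N < k" by (simp add: power_strict_increasing_iff)
      then have tk: "\<phi> (2 ^ k) / 2 ^ k < e / 2"
        using N[of k] adm(1)[of "2 ^ k"] by simp
      have "real (2 ^ k) < real (2 * n)" using k(2) by (rule of_nat_less_iff[THEN iffD2])
      then have k2: "2 ^ k < 2 * real n" by simp
      have "\<phi> n \<le> \<phi> (2 ^ k)" using adm(2)[of n "2 ^ k"] k n1 by simp
      also have "\<dots> < e / 2 * 2 ^ k" using tk by (simp add: field_simps)
      also have "\<dots> < e / 2 * (2 * real n)" using k2 \<open>0 < e\<close> by simp
      finally have "\<phi> n < e * real n" by simp
      then show "norm (\<phi> n / real n - 0) < e"
        using adm(1)[of n] n1 by (simp add: field_simps)
    qed
  qed
qed

text \<open>Repeated halving: an index of size at most 2^i is split at cost at most \<psi>(2^i), and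
  at most 2^(k-i) such splittings occur.\<close>

lemma almost_subadditive_dyadic:
  assumes sub: "almost_subadditive \<psi> a"
    and mono: "\<And>m n. 1 \<le> m \<Longrightarrow> m \<le> n \<Longrightarrow> \<psi> m \<le> \<psi> n"
    and nonneg: "\<And>n. 1 \<le> n \<Longrightarrow> 0 \<le> \<psi> n"
  shows "1 \<le> n \<Longrightarrow> n \<le> 2 ^ k \<Longrightarrow> a n \<le> real n * a 1 + 2 ^ k * (\<Sum>i=1..k. \<psi> (2 ^ i) / 2 ^ i)"
proof (induction k arbitrary: n)
  case 0
  then have "n = 1" by simp
  then show ?case by simp
next
  case (Suc k)
  let ?T = "\<lambda>k. \<Sum>i=1..k. \<psi> (2 ^ i) / 2 ^ i"
  have T: "2 ^ Suc k * ?T (Suc k) = 2 * (2 ^ k * ?T k) + \<psi> (2 ^ Suc k)"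
    by (simp add: algebra_simps)
  show ?case
  proof (cases "n = 1")
    case True
    have "0 \<le> ?T (Suc k)"
      by (intro sum_nonneg divide_nonneg_pos nonneg) auto
    then show ?thesis using True by simp
  next
    case False
    define p where "p = n div 2"
    define q where "q = n - p"
    have pq: "1 \<le> p" "1 \<le> q" "p \<le> 2 ^ k" "q \<le> 2 ^ k" and n: "n = p + q"
      using False Suc.prems by (auto simp: p_def q_def)
    have "a n \<le> a p + a q + \<psi> n"
      using sub pq n unfolding almost_subadditive_def by blast
    also have "\<psi> n \<le> \<psi> (2 ^ Suc k)"
      using mono Suc.prems by blast
    also have "a p \<le> real p * a 1 + 2 ^ k * ?T k"
      using Suc.IH pq by blast
    also have "a q \<le> real q * a 1 + 2 ^ k * ?T k"
      using Suc.IH pq by blast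
    finally show ?thesis
      unfolding T using n by (simp add: algebra_simps)
  qed
qed

text \<open>The halving bound for the sequence sampled at multiples of \<open>m\<close>. The factor
  2 is the loss in rounding \<open>n\<close> up to a power of two.\<close>

lemma almost_subadditive_multiple:
  assumes adm: "dyadic_admissible \<phi> D" and sub: "almost_subadditive \<phi> a"
    and "1 \<le> m" "1 \<le> n"
  shows "a (n * m) \<le> real n * (a m + 2 * D * \<phi> m)"
proof -
  note A = dyadic_admissibleD[OF adm]
  let ?T = "\<lambda>k. \<Sum>i=1..k. \<phi> (2 ^ i * m) / 2 ^ i"
  obtain k where k: "n \<le> 2 ^ k" "2 ^ k < 2 * n"
    using dyadic_bracket[OF \<open>1 \<le> n\<close>] by blast
  have "real (2 ^ k) < real (2 * n)" using k(2) by (rule of_nat_less_iff[THEN iffD2])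
  then have k2: "2 ^ k \<le> 2 * real n" by simp
  have pos: "1 \<le> i * m" if "1 \<le> i" for i using that \<open>1 \<le> m\<close> by simp
  have "almost_subadditive (\<lambda>n. \<phi> (n * m)) (\<lambda>n. a (n * m))"
    using sub pos unfolding almost_subadditive_def by (simp add: add_mult_distrib)
  then have "a (n * m) \<le> real n * a (1 * m) + 2 ^ k * ?T k"
    by (rule almost_subadditive_dyadic) (use A pos \<open>1 \<le> n\<close> k in auto)
  also have "2 ^ k * ?T k \<le> 2 * real n * (D * \<phi> m)"
  proof (rule mult_mono)
    show "0 \<le> ?T k" by (intro sum_nonneg divide_nonneg_pos A(1) pos) auto
  qed (use A(4)[OF \<open>1 \<le> m\<close>] k2 in auto)
  finally show ?thesis by (simp add: algebra_simps)
qed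

text \<open>Fekete's argument for the corrected quotient \<open>c m\<close>, which by
  \<open>almost_subadditive_multiple\<close> controls the growth along all multiples of
  \<open>m\<close>. The limit is its infimum; the correction vanishes in the limit since \<phi>(m) /
  m tends to 0.\<close>

lemma almost_subadditive_limit:
  assumes adm: "dyadic_admissible \<phi> D" and sub: "almost_subadditive \<phi> a"
    and nonneg: "\<And>n. 0 \<le> a n"
  obtains L where "(\<lambda>n. a n / real n) \<longlonglongrightarrow> L"
    "\<And>m. 1 \<le> m \<Longrightarrow> L \<le> (a m + 2 * D * \<phi> m) / real m"
proof -
  note A = dyadic_admissibleD[OF adm]
  define c where "c = (\<lambda>m. (a m + 2 * D * \<phi> m) / real m)"
  define L where "L = Inf (c ` {1..})"
  have c_nonneg: "0 \<le> c m" if "1 \<le> m" for m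
    using nonneg[of m] A(1)[OF that] A(3) by (simp add: c_def)
  have bdd: "bdd_below (c ` {1..})"
    using c_nonneg by (auto intro!: bdd_belowI[of _ 0])
  have L_le: "L \<le> c m" if "1 \<le> m" for m
    unfolding L_def using that by (intro cInf_lower bdd) auto
  have phi0: "(\<lambda>n. \<phi> n / real n) \<longlonglongrightarrow> 0"
    by (rule dyadic_admissible_sublinear[OF adm])
  have upper: "\<forall>\<^sub>F n in sequentially. a n / real n \<le> L + e" if "0 < e" for e
  proof -
    obtain m where m: "1 \<le> m" "c m < L + e / 2"
      using cInf_lessD[of "c ` {1..}" "L + e / 2"] \<open>0 < e\<close> unfolding L_def by auto
    \<comment> \<open>\<open>M\<close> bounds the contribution of every remainder of division by
      \<open>m\<close>, independently of \<open>n\<close>.\<close>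
    define M where "M = (\<Sum>r<m. a r)"
    have aM: "a r \<le> M" if "r < m" for r
      unfolding M_def using that nonneg by (intro member_le_sum) auto
    have "(\<lambda>n. M / real n + \<phi> n / real n) \<longlonglongrightarrow> 0 + 0"
      by (intro tendsto_add phi0 lim_const_over_n)
    then have "\<forall>\<^sub>F n in sequentially. M / real n + \<phi> n / real n < e / 2"
      using \<open>0 < e\<close> by (intro order_tendstoD) auto
    moreover have "\<forall>\<^sub>F n in sequentially. m \<le> n" by (rule eventually_ge_at_top)
    ultimately show ?thesis
    proof eventually_elim
      case (elim n)
      define q where "q = n div m"
      define r where "r = n mod m"
      have n: "n = q * m + r" and r: "r < m" and q: "1 \<le> q" and n1: "1 \<le> n"
        using m(1) elim(2) by (auto simp: q_def r_def div_greater_zero_iff Suc_le_eq)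
      have M0: "0 \<le> M" unfolding M_def by (intro sum_nonneg nonneg)
      have "a n \<le> a (q * m) + M + \<phi> n"
      proof (cases "r = 0")
        case True
        then show ?thesis using n M0 A(1)[OF n1] by simp
      next
        case False
        have "a n \<le> a (q * m) + a r + \<phi> n"
          using sub[unfolded almost_subadditive_def, rule_format, of "q * m" r] n False q m(1) by simp
        then show ?thesis using aM[OF r] by linarith
      qed
      also have "a (q * m) \<le> real q * (a m + 2 * D * \<phi> m)"
        by (rule almost_subadditive_multiple[OF adm sub m(1) q])
      also have "\<dots> = real (q * m) * c m" using m(1) by (simp add: c_def)
      also have "\<dots> \<le> real n * c m"
        using n c_nonneg[OF m(1)] by (intro mult_right_mono) auto
      also have "\<dots> \<le> real n * (L + e / 2)" using m(2) by (intro mult_left_mono) auto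
      finally have "a n / real n \<le> L + e / 2 + (M / real n + \<phi> n / real n)"
        using n1 by (simp add: field_simps)
      then show ?case using elim(1) by linarith
    qed
  qed
  have "(\<lambda>n. a n / real n) \<longlonglongrightarrow> L"
  proof (rule tendstoI)
    fix e :: real assume "0 < e"
    have "(\<lambda>n. 2 * D * (\<phi> n / real n)) \<longlonglongrightarrow> 2 * D * 0"
      by (intro tendsto_mult_left phi0)
    then have "\<forall>\<^sub>F n in sequentially. 2 * D * (\<phi> n / real n) < e / 2"
      using \<open>0 < e\<close> by (intro order_tendstoD) auto
    moreover have "\<forall>\<^sub>F n in sequentially. a n / real n \<le> L + e / 2"
      using \<open>0 < e\<close> by (intro upper) auto
    moreover have "\<forall>\<^sub>F n in sequentially. (1::nat) \<le> n" by (rule eventually_ge_at_top)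
    ultimately show "\<forall>\<^sub>F n in sequentially. dist (a n / real n) L < e"
    proof eventually_elim
      case (elim n)
      have "L \<le> a n / real n + 2 * D * (\<phi> n / real n)"
        using L_le[OF elim(3)] by (simp add: c_def add_divide_distrib)
      then show ?case using elim \<open>0 < e\<close> by (simp add: dist_real_def abs_less_iff)
    qed
  qed
  then show ?thesis using that L_le unfolding c_def by blast
qed

section \<open>Pseudo-metric commutative monoids\<close>

definition lim_dist :: "('a \<Rightarrow> 'a \<Rightarrow> real) \<Rightarrow> (nat \<Rightarrow> 'a) \<Rightarrow> (nat \<Rightarrow> 'a) \<Rightarrow> real" where
  "lim_dist d X Y = lim (\<lambda>n. d (X n) (Y n) / real n)"

lemma lim_distI: "(\<lambda>n. d (X n) (Y n) / real n) \<longlonglongrightarrow> L \<Longrightarrow> lim_dist d X Y = L"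
  unfolding lim_dist_def by (rule limI)

text \<open>Factors are added on the left, starting from the unit, in agreement with
  \<open>tensor_power\<close>.\<close>

definition pow :: "('a \<Rightarrow> 'a \<Rightarrow> 'a) \<Rightarrow> 'a \<Rightarrow> 'a \<Rightarrow> nat \<Rightarrow> 'a" where
  "pow ten u x n = (ten x ^^ n) u"

lemma pow_0 [simp]: "pow ten u x 0 = u"
  by (simp add: pow_def)

lemma pow_Suc [simp]: "pow ten u x (Suc n) = ten x (pow ten u x n)"
  by (simp add: pow_def)

text \<open>Only positive indices are constrained; the normalisation at index 0 is imposed
  separately, by the set \<open>Q\<close> of the final proof.\<close>

definition qlin :: "'a set \<Rightarrow> ('a \<Rightarrow> 'a \<Rightarrow> 'a) \<Rightarrow> ('a \<Rightarrow> 'a \<Rightarrow> real) \<Rightarrow> (nat \<Rightarrow> real) \<Rightarrow> (nat \<Rightarrow> 'a) set" where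
  "qlin P ten d \<phi> = {X. (\<forall>i. X i \<in> P) \<and>
     (\<exists>C\<ge>0. \<forall>m\<ge>1. \<forall>n\<ge>1. d (X (m + n)) (ten (X m) (X n)) \<le> C * \<phi> (m + n))}"

lemma qlin_closed: "X \<in> qlin P ten d \<phi> \<Longrightarrow> X i \<in> P"
  by (simp add: qlin_def)

text \<open>Tensor products of diagrams are commutative, associative and unital only up to
  isomorphism, as pairs are encoded by numbers. The laws are therefore equalities at distance 0, and
  \<open>dist_cong\<close> takes the place of rewriting.\<close>

locale metric_monoid =
  fixes P :: "'a set" and ten :: "'a \<Rightarrow> 'a \<Rightarrow> 'a" and u :: 'a and d :: "'a \<Rightarrow> 'a \<Rightarrow> real"
  assumes ten_closed [simp, intro]: "x \<in> P \<Longrightarrow> y \<in> P \<Longrightarrow> ten x y \<in> P"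
    and unit_closed [simp, intro]: "u \<in> P"
    and nonneg: "x \<in> P \<Longrightarrow> y \<in> P \<Longrightarrow> 0 \<le> d x y"
    and self [simp]: "x \<in> P \<Longrightarrow> d x x = 0"
    and sym: "x \<in> P \<Longrightarrow> y \<in> P \<Longrightarrow> d x y = d y x"
    and tri: "x \<in> P \<Longrightarrow> y \<in> P \<Longrightarrow> z \<in> P \<Longrightarrow> d x z \<le> d x y + d y z"
    and lip: "x \<in> P \<Longrightarrow> y \<in> P \<Longrightarrow> x' \<in> P \<Longrightarrow> y' \<in> P \<Longrightarrow>
      d (ten x y) (ten x' y') \<le> d x x' + d y y'"
    and comm: "x \<in> P \<Longrightarrow> y \<in> P \<Longrightarrow> d (ten x y) (ten y x) = 0"
    and assoc: "x \<in> P \<Longrightarrow> y \<in> P \<Longrightarrow> z \<in> P \<Longrightarrow> d (ten (ten x y) z) (ten x (ten y z)) = 0"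
    and unit: "x \<in> P \<Longrightarrow> d (ten u x) x = 0"
begin

abbreviation pw :: "'a \<Rightarrow> nat \<Rightarrow> 'a" where "pw \<equiv> pow ten u"

definition kap :: "'a \<Rightarrow> 'a \<Rightarrow> real" where "kap x y = lim_dist d (pw x) (pw y)"

section \<open>Calculating up to distance zero\<close>

lemma trans0: "d x y = 0 \<Longrightarrow> d y z = 0 \<Longrightarrow> x \<in> P \<Longrightarrow> y \<in> P \<Longrightarrow> z \<in> P \<Longrightarrow> d x z = 0"
  using tri[of x y z] nonneg[of x z] by simp

lemma sym0: "d x y = 0 \<Longrightarrow> x \<in> P \<Longrightarrow> y \<in> P \<Longrightarrow> d y x = 0"
  using sym by metis

lemma cong0: "d x x' = 0 \<Longrightarrow> d y y' = 0 \<Longrightarrow> x \<in> P \<Longrightarrow> y \<in> P \<Longrightarrow> x' \<in> P \<Longrightarrow> y' \<in> P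
    \<Longrightarrow> d (ten x y) (ten x' y') = 0"
  using lip[of x y x' y'] nonneg[of "ten x y" "ten x' y'"] by simp

lemma dist_cong:
  assumes "d x x' = 0" "d y y' = 0" "x \<in> P" "y \<in> P" "x' \<in> P" "y' \<in> P"
  shows "d x y = d x' y'"
proof -
  have "d x y \<le> d x' y'" if "d x x' = 0" "d y y' = 0" "x \<in> P" "y \<in> P" "x' \<in> P" "y' \<in> P" for x x' y y'
    using tri[of x x' y] tri[of x' y' y] sym0[of y y'] that by simp
  from this[of x x' y y'] this[of x' x y' y] show ?thesis
    using assms sym0 by (meson order_antisym)
qed

lemma pw_closed [simp, intro]: "x \<in> P \<Longrightarrow> pw x n \<in> P"
  by (induction n) auto

lemma pw_1: "x \<in> P \<Longrightarrow> d (pw x 1) x = 0"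
  using trans0[OF comm unit, of x] by auto

lemma pw_add: "x \<in> P \<Longrightarrow> d (pw x (m + n)) (ten (pw x m) (pw x n)) = 0"
proof (induction m)
  case 0
  then show ?case using sym0[OF unit] by simp
next
  case (Suc m)
  have 1: "d (ten x (pw x (m + n))) (ten x (ten (pw x m) (pw x n))) = 0"
    by (rule cong0) (use Suc in auto)
  have 2: "d (ten x (ten (pw x m) (pw x n))) (ten (ten x (pw x m)) (pw x n)) = 0"
    by (rule sym0[OF assoc]) (use Suc in auto)
  from trans0[OF 1 2] Suc show ?case by auto
qed

lemma left_comm:
  assumes "b \<in> P" "c \<in> P" "e \<in> P"
  shows "d (ten b (ten c e)) (ten c (ten b e)) = 0"
proof (rule trans0)
  show "d (ten b (ten c e)) (ten (ten b c) e) = 0"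
    by (rule sym0[OF assoc]) (use assms in auto)
  show "d (ten (ten b c) e) (ten c (ten b e)) = 0"
    by (rule trans0[OF cong0[OF comm self] assoc]) (use assms in auto)
qed (use assms in auto)

lemma interchange:
  assumes "a \<in> P" "b \<in> P" "c \<in> P" "e \<in> P"
  shows "d (ten (ten a b) (ten c e)) (ten (ten a c) (ten b e)) = 0"
proof -
  have "d (ten (ten a b) (ten c e)) (ten a (ten c (ten b e))) = 0"
    by (rule trans0[OF assoc cong0[OF self left_comm]]) (use assms in auto)
  moreover have "d (ten a (ten c (ten b e))) (ten (ten a c) (ten b e)) = 0"
    by (rule sym0[OF assoc]) (use assms in auto)
  ultimately show ?thesis
    by (rule trans0) (use assms in auto)
qed

lemma pw_ten: "x \<in> P \<Longrightarrow> y \<in> P \<Longrightarrow> d (pw (ten x y) n) (ten (pw x n) (pw y n)) = 0"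
proof (induction n)
  case 0
  then show ?case using sym0[OF unit] by simp
next
  case (Suc n)
  have "d (ten (ten x y) (pw (ten x y) n)) (ten (ten x y) (ten (pw x n) (pw y n))) = 0"
    by (rule cong0) (use Suc in auto)
  then show ?case
    using trans0[OF _ interchange] Suc.prems by auto
qed

lemma pw_unit: "d (pw u n) u = 0"
proof (induction n)
  case (Suc n)
  show ?case using trans0[OF unit Suc] by auto
qed simp

lemma pw_mult: "x \<in> P \<Longrightarrow> d (pw x (n * m)) (pw (pw x m) n) = 0"
proof (induction n)
  case (Suc n)
  have "d (ten (pw x m) (pw x (n * m))) (ten (pw x m) (pw (pw x m) n)) = 0"
    by (rule cong0) (use Suc in auto)
  then show ?case
    using trans0[OF pw_add, of x m "n * m"] Suc.prems by simp
qed simp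

lemma pw_lip: "x \<in> P \<Longrightarrow> y \<in> P \<Longrightarrow> d (pw x n) (pw y n) \<le> real n * d x y"
proof (induction n)
  case (Suc n)
  then show ?case
    using lip[of x "pw x n" y "pw y n"] by (auto simp: algebra_simps)
qed simp

text \<open>The surplus factors are compared with as many copies of the unit, one by one, so each
  costs \<open>d x u\<close>.\<close>

lemma pw_diff:
  assumes "x \<in> P"
  shows "d (pw x m) (pw x n) \<le> \<bar>real m - real n\<bar> * d x u"
proof -
  have le: "d (pw x (n + j)) (pw x n) \<le> real j * d x u" for n j
  proof -
    have "d (pw x (n + j)) (pw x n) = d (ten (pw x n) (pw x j)) (ten (pw x n) u)"
    proof (rule dist_cong[OF pw_add])
      show "d (pw x n) (ten (pw x n) u) = 0"
        using sym0[OF trans0[OF comm unit], of "pw x n"] assms by auto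
    qed (use assms in auto)
    also have "\<dots> \<le> d (pw x n) (pw x n) + d (pw x j) u"
      by (rule lip) (use assms in auto)
    also have "\<dots> = d (pw x j) (pw u j)"
      using dist_cong[OF self sym0[OF pw_unit], of "pw x j" j] assms by auto
    also have "\<dots> \<le> real j * d x u" by (rule pw_lip) (use assms in auto)
    finally show ?thesis .
  qed
  show ?thesis
  proof (cases "n \<le> m")
    case True
    then show ?thesis using le[of n "m - n"] by (simp add: of_nat_diff)
  next
    case False
    then show ?thesis using le[of m "n - m"] sym[of "pw x m" "pw x n"] assms by (simp add: of_nat_diff)
  qed
qed

subsection \<open>Asymptotic distance of quasi-linear sequences\<close>

text \<open>A detour through \<open>ten (X m) (X n)\<close> and \<open>ten (Y m) (Y n)\<close>: the
  two outer legs are defects, and the middle leg splits by \<open>lip\<close>.\<close>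

lemma qlin_almost_subadditive:
  assumes X: "X \<in> qlin P ten d \<phi>" and Y: "Y \<in> qlin P ten d \<phi>"
  obtains C where "0 \<le> C" "almost_subadditive (\<lambda>n. C * \<phi> n) (\<lambda>n. d (X n) (Y n))"
proof -
  obtain A where A: "0 \<le> A" "\<And>m n. 1 \<le> m \<Longrightarrow> 1 \<le> n \<Longrightarrow> d (X (m + n)) (ten (X m) (X n)) \<le> A * \<phi> (m + n)"
    using X unfolding qlin_def by blast
  obtain B where B: "0 \<le> B" "\<And>m n. 1 \<le> m \<Longrightarrow> 1 \<le> n \<Longrightarrow> d (Y (m + n)) (ten (Y m) (Y n)) \<le> B * \<phi> (m + n)"
    using Y unfolding qlin_def by blast
  note [simp] = qlin_closed[OF X] qlin_closed[OF Y]
  have "almost_subadditive (\<lambda>n. (A + B) * \<phi> n) (\<lambda>n. d (X n) (Y n))"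
    unfolding almost_subadditive_def
  proof (intro allI impI)
    fix m n :: nat assume mn: "1 \<le> m" "1 \<le> n"
    let ?x = "ten (X m) (X n)" and ?y = "ten (Y m) (Y n)"
    have "d (X (m + n)) (Y (m + n)) \<le> d (X (m + n)) ?x + d ?x (Y (m + n))"
      by (rule tri) auto
    also have "d ?x (Y (m + n)) \<le> d ?x ?y + d ?y (Y (m + n))"
      by (rule tri) auto
    also have "d ?y (Y (m + n)) = d (Y (m + n)) ?y" by (rule sym) auto
    also have "d ?x ?y \<le> d (X m) (Y m) + d (X n) (Y n)" by (rule lip) auto
    finally show "d (X (m + n)) (Y (m + n)) \<le> d (X m) (Y m) + d (X n) (Y n) + (A + B) * \<phi> (m + n)"
      using A(2)[OF mn] B(2)[OF mn] by (simp add: algebra_simps)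
  qed
  then show ?thesis using that A(1) B(1) by (metis add_nonneg_nonneg)
qed

lemma lim_dist_tendsto:
  assumes adm: "dyadic_admissible \<phi> D" and X: "X \<in> qlin P ten d \<phi>" and Y: "Y \<in> qlin P ten d \<phi>"
  shows "(\<lambda>n. d (X n) (Y n) / real n) \<longlonglongrightarrow> lim_dist d X Y"
proof -
  obtain C where C: "0 \<le> C" "almost_subadditive (\<lambda>n. C * \<phi> n) (\<lambda>n. d (X n) (Y n))"
    using qlin_almost_subadditive[OF X Y] by blast
  have "0 \<le> d (X n) (Y n)" for n
    using nonneg qlin_closed[OF X] qlin_closed[OF Y] by blast
  then obtain L where "(\<lambda>n. d (X n) (Y n) / real n) \<longlonglongrightarrow> L"
    using almost_subadditive_limit[OF dyadic_admissible_scale[OF adm C(1)] C(2)] by blast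
  then show ?thesis using lim_distI[of d X Y] by metis
qed

lemma lim_dist_pseudo_metric:
  assumes adm: "dyadic_admissible \<phi> D"
    and X: "X \<in> qlin P ten d \<phi>" and Y: "Y \<in> qlin P ten d \<phi>" and Z: "Z \<in> qlin P ten d \<phi>"
  shows "0 \<le> lim_dist d X Y" "lim_dist d X X = 0" "lim_dist d X Y = lim_dist d Y X"
    "lim_dist d X Z \<le> lim_dist d X Y + lim_dist d Y Z"
proof -
  note t = lim_dist_tendsto[OF adm]
  note [simp] = qlin_closed[OF X] qlin_closed[OF Y] qlin_closed[OF Z]
  show "0 \<le> lim_dist d X Y"
    by (rule LIMSEQ_le_const[OF t[OF X Y]]) (simp add: nonneg)
  show "lim_dist d X X = 0"
    by (rule lim_distI) simp
  have "d (X n) (Y n) = d (Y n) (X n)" for n by (simp add: sym)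
  then show "lim_dist d X Y = lim_dist d Y X" by (simp add: lim_dist_def)
  have "d (X n) (Z n) / real n \<le> d (X n) (Y n) / real n + d (Y n) (Z n) / real n" for n
    using divide_right_mono[OF tri[of "X n" "Y n" "Z n"], of "real n"] by (simp add: add_divide_distrib)
  then show "lim_dist d X Z \<le> lim_dist d X Y + lim_dist d Y Z"
    by (intro LIMSEQ_le[OF t[OF X Z] tendsto_add[OF t[OF X Y] t[OF Y Z]]]) auto
qed

section \<open>Power sequences, linear sequences and the distance \<open>kap\<close>\<close>

lemma pw_in_qlin:
  assumes "x \<in> P"
  shows "pw x \<in> qlin P ten d \<phi>"
proof -
  have "d (pw x (m + n)) (ten (pw x m) (pw x n)) \<le> 0 * \<phi> (m + n)" for m n
    using pw_add[OF assms] by simp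
  then show ?thesis
    unfolding qlin_def using assms by (auto intro!: exI[of _ "0::real"])
qed

lemma kap_tendsto:
  assumes "x \<in> P" "y \<in> P"
  shows "(\<lambda>n. d (pw x n) (pw y n) / real n) \<longlonglongrightarrow> kap x y"
  unfolding kap_def
  by (intro lim_dist_tendsto[OF dyadic_admissible_zero] pw_in_qlin assms)

lemma kap_le: "x \<in> P \<Longrightarrow> y \<in> P \<Longrightarrow> kap x y \<le> d x y"
proof (rule LIMSEQ_le_const2[OF kap_tendsto])
  assume xy: "x \<in> P" "y \<in> P"
  have "d (pw x n) (pw y n) / real n \<le> d x y" if "1 \<le> n" for n
    using pw_lip[OF xy, of n] that by (simp add: field_simps)
  then show "\<exists>N. \<forall>n\<ge>N. d (pw x n) (pw y n) / real n \<le> d x y" by blast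
qed

lemma kap_nonneg: "x \<in> P \<Longrightarrow> y \<in> P \<Longrightarrow> 0 \<le> kap x y"
  unfolding kap_def
  using lim_dist_pseudo_metric(1)[OF dyadic_admissible_zero] pw_in_qlin by blast

lemma kap_eq_0: "d x y = 0 \<Longrightarrow> x \<in> P \<Longrightarrow> y \<in> P \<Longrightarrow> kap x y = 0"
  using kap_le[of x y] kap_nonneg[of x y] by simp

text \<open>Distance 0 for \<open>d\<close> forces distance 0 for \<open>kap\<close>, so the monoid
  laws are inherited, while the triangle inequality and the Lipschitz bound pass to the limit. With
  this, results proved for \<open>d\<close> become available for \<open>kap\<close>.\<close>

lemma kap_metric_monoid: "metric_monoid P ten u kap"
proof
  note m = lim_dist_pseudo_metric[OF dyadic_admissible_zero]
  note p = pw_in_qlin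
  fix x y z x' y' assume P [simp]: "x \<in> P" "y \<in> P" "z \<in> P" "x' \<in> P" "y' \<in> P"
  show "kap x y = kap y x" "kap x z \<le> kap x y + kap y z"
    unfolding kap_def using m(3)[OF p p p, of x y x] m(4)[OF p p p, of x y z] P by simp_all
  have le: "d (pw (ten x y) n) (pw (ten x' y') n) / real n
      \<le> d (pw x n) (pw x' n) / real n + d (pw y n) (pw y' n) / real n" for n
  proof -
    have "d (pw (ten x y) n) (pw (ten x' y') n) = d (ten (pw x n) (pw y n)) (ten (pw x' n) (pw y' n))"
      by (rule dist_cong[OF pw_ten pw_ten]) auto
    also have "\<dots> \<le> d (pw x n) (pw x' n) + d (pw y n) (pw y' n)"
      by (rule lip) auto
    finally show ?thesis
      by (metis add_divide_distrib divide_right_mono of_nat_0_le_iff)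
  qed
  then show "kap (ten x y) (ten x' y') \<le> kap x x' + kap y y'"
    by (intro LIMSEQ_le[OF kap_tendsto tendsto_add[OF kap_tendsto kap_tendsto]]) auto
qed (auto simp: kap_nonneg kap_eq_0 comm assoc unit)

text \<open>With zero defect a sequence is rebuilt from \<open>X 1\<close> by induction. Index 0 is
  set apart because membership in \<open>qlin\<close> leaves \<open>X 0\<close> an arbitrary point
  of \<open>P\<close>.\<close>

lemma linear_pw:
  assumes X: "X \<in> qlin P ten d (\<lambda>_. 0)"
  shows "d (pw (X 1) n) (X n) = 0 \<or> n = 0"
proof (induction n)
  case (Suc n)
  have [simp]: "X i \<in> P" for i using qlin_closed[OF X] .
  show ?case
  proof (cases "n = 0")
    case True
    then show ?thesis using pw_1[of "X 1"] by simp
  next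
    case False
    have "d (X (1 + n)) (ten (X 1) (X n)) \<le> 0"
      using X False unfolding qlin_def by fastforce
    then have 2: "d (ten (X 1) (X n)) (X (Suc n)) = 0"
      using nonneg[of "X (1 + n)" "ten (X 1) (X n)"] sym0[of "X (1 + n)" "ten (X 1) (X n)"] by simp
    have 1: "d (ten (X 1) (pw (X 1) n)) (ten (X 1) (X n)) = 0"
      by (rule cong0) (use Suc False in auto)
    show ?thesis using trans0[OF 1 2] by auto
  qed
qed simp

lemma lim_dist_linear_pw:
  assumes X: "X \<in> qlin P ten d (\<lambda>_. 0)"
  shows "lim_dist d (pw (X 1)) X = 0"
proof (rule lim_distI)
  have "d (pw (X 1) n) (X n) / real n = 0" for n
    using linear_pw[OF X, of n] by auto
  then show "(\<lambda>n. d (pw (X 1) n) (X n) / real n) \<longlonglongrightarrow> 0" by (simp only: tendsto_const)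
qed

text \<open>The quotients for the \<open>n\<close>-th powers, divided by \<open>n\<close>, form the
  subsequence at multiples of \<open>n\<close> of the quotients that define
  \<open>kap x y\<close>.\<close>

lemma kap_pw: "x \<in> P \<Longrightarrow> y \<in> P \<Longrightarrow> kap (pw x n) (pw y n) = real n * kap x y"
proof (cases "n = 0")
  case False
  assume [simp]: "x \<in> P" "y \<in> P"
  have "strict_mono (\<lambda>j. j * n)" using False by (simp add: strict_mono_def)
  then have "(\<lambda>j. d (pw x (j * n)) (pw y (j * n)) / real (j * n)) \<longlonglongrightarrow> kap x y"
    using LIMSEQ_subseq_LIMSEQ[OF kap_tendsto[of x y], of "\<lambda>j. j * n"] by (simp add: comp_def)
  moreover have "d (pw x (j * n)) (pw y (j * n)) = d (pw (pw x n) j) (pw (pw y n) j)" for j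
    by (rule dist_cong[OF pw_mult pw_mult]) auto
  ultimately have "(\<lambda>j. real n * (d (pw (pw x n) j) (pw (pw y n) j) / real (j * n))) \<longlonglongrightarrow> real n * kap x y"
    by (intro tendsto_mult_left) simp
  then have "(\<lambda>j. d (pw (pw x n) j) (pw (pw y n) j) / real j) \<longlonglongrightarrow> real n * kap x y"
    using False by simp
  then show ?thesis
    unfolding kap_def[of "pw x n"] by (rule lim_distI)
qed (simp add: kap_eq_0)

text \<open>By homogeneity the quotients are constant from index 1 on, so a second passage to the
  limit changes nothing. This makes the power map into the \<kappa>-linear sequences
  distance-preserving.\<close>

lemma lim_dist_kap_pw:
  assumes "x \<in> P" "y \<in> P"
  shows "lim_dist kap (pw x) (pw y) = kap x y"
proof (rule lim_distI)
  have "\<forall>\<^sub>F n in sequentially. kap x y = kap (pw x n) (pw y n) / real n"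
    using eventually_gt_at_top[of 0] by eventually_elim (simp add: kap_pw assms)
  then show "(\<lambda>n. kap (pw x n) (pw y n) / real n) \<longlonglongrightarrow> kap x y"
    by (rule Lim_transform_eventually[OF tendsto_const])
qed

lemma qlin_kap:
  assumes "X \<in> qlin P ten d \<phi>"
  shows "X \<in> qlin P ten kap \<phi>"
proof -
  note [simp] = qlin_closed[OF assms]
  obtain C where C: "0 \<le> C" "\<And>m n. 1 \<le> m \<Longrightarrow> 1 \<le> n \<Longrightarrow> d (X (m + n)) (ten (X m) (X n)) \<le> C * \<phi> (m + n)"
    using assms unfolding qlin_def by blast
  have "kap (X (m + n)) (ten (X m) (X n)) \<le> C * \<phi> (m + n)" if "1 \<le> m" "1 \<le> n" for m n
    by (rule order_trans[OF kap_le C(2)]) (use that in auto)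
  then show ?thesis
    using C(1) unfolding qlin_def by auto
qed

text \<open>The distance between \<open>X (n * m)\<close> and the \<open>n\<close>-th power of
  \<open>X m\<close> is almost subadditive in \<open>n\<close> and vanishes at \<open>n = 1\<close>.
  Only the accumulated defects remain, and admissibility bounds them by a multiple of \<phi>(m) per
  factor.\<close>

lemma qlin_multiple:
  assumes adm: "dyadic_admissible \<phi> D" and X: "X \<in> qlin P ten d \<phi>"
  obtains C where "0 \<le> C"
    "\<And>m n. 1 \<le> m \<Longrightarrow> 1 \<le> n \<Longrightarrow> d (X (n * m)) (pw (X m) n) \<le> real n * (C * \<phi> m)"
proof -
  note [simp] = qlin_closed[OF X]
  obtain A where A: "0 \<le> A" "\<And>m n. 1 \<le> m \<Longrightarrow> 1 \<le> n \<Longrightarrow> d (X (m + n)) (ten (X m) (X n)) \<le> A * \<phi> (m + n)"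
    using X unfolding qlin_def by blast
  note adm' = dyadic_admissible_scale[OF adm A(1)]
  have "d (X (n * m)) (pw (X m) n) \<le> real n * (2 * D * A * \<phi> m)" if mn: "1 \<le> m" "1 \<le> n" for m n
  proof -
    have pos: "1 \<le> i * m" if "1 \<le> i" for i using that \<open>1 \<le> m\<close> by simp
    have "almost_subadditive (\<lambda>n. A * \<phi> (n * m)) (\<lambda>n. d (X (n * m)) (pw (X m) n))"
      unfolding almost_subadditive_def
    proof (intro allI impI)
      fix p q :: nat assume pq: "1 \<le> p" "1 \<le> q"
      let ?x = "ten (X (p * m)) (X (q * m))" and ?y = "ten (pw (X m) p) (pw (X m) q)"
      have "d (X ((p + q) * m)) (pw (X m) (p + q)) \<le> d (X (p * m + q * m)) ?x + d ?x (pw (X m) (p + q))"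
        unfolding add_mult_distrib by (rule tri) auto
      also have "d ?x (pw (X m) (p + q)) \<le> d ?x ?y + d ?y (pw (X m) (p + q))"
        by (rule tri) auto
      also have "d ?y (pw (X m) (p + q)) = 0" by (rule sym0[OF pw_add]) auto
      also have "d ?x ?y \<le> d (X (p * m)) (pw (X m) p) + d (X (q * m)) (pw (X m) q)"
        by (rule lip) auto
      finally show "d (X ((p + q) * m)) (pw (X m) (p + q)) \<le>
          d (X (p * m)) (pw (X m) p) + d (X (q * m)) (pw (X m) q) + A * \<phi> ((p + q) * m)"
        using A(2)[OF pos[OF pq(1)] pos[OF pq(2)]] by (simp add: add_mult_distrib)
    qed
    from almost_subadditive_multiple[OF dyadic_admissible_dilate[OF adm' mn(1)] this order_refl mn(2)]
    have "d (X (n * m)) (pw (X m) n) \<le> real n * (d (X m) (pw (X m) 1) + 2 * D * (A * \<phi> m))"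
      by simp
    also have "d (X m) (pw (X m) 1) = 0"
      by (rule sym0[OF pw_1]) auto
    finally show ?thesis by (simp add: mult.assoc)
  qed
  moreover have "0 \<le> 2 * D * A" using A(1) dyadic_admissibleD(3)[OF adm] by simp
  ultimately show ?thesis using that[of "2 * D * A"] by simp
qed

text \<open>Along multiples of \<open>m\<close>, the \<open>d\<close>-distance is \<open>kap (X m) (Y m)\<close> up to \<open>O(\<phi> m)\<close>, which is
  negligible compared with \<open>m\<close>.\<close>

lemma lim_dist_kap:
  assumes adm: "dyadic_admissible \<phi> D" and X: "X \<in> qlin P ten d \<phi>" and Y: "Y \<in> qlin P ten d \<phi>"
  shows "lim_dist kap X Y = lim_dist d X Y"
proof (rule antisym)
  note [simp] = qlin_closed[OF X] qlin_closed[OF Y]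
  interpret K: metric_monoid P ten u kap by (rule kap_metric_monoid)
  note td = lim_dist_tendsto[OF adm X Y]
  note tk = K.lim_dist_tendsto[OF adm qlin_kap[OF X] qlin_kap[OF Y]]
  show "lim_dist kap X Y \<le> lim_dist d X Y"
    by (rule LIMSEQ_le[OF tk td]) (auto intro!: divide_right_mono kap_le)
  obtain A where A: "0 \<le> A"
    "\<And>m n. 1 \<le> m \<Longrightarrow> 1 \<le> n \<Longrightarrow> d (X (n * m)) (pw (X m) n) \<le> real n * (A * \<phi> m)"
    using qlin_multiple[OF adm X] by blast
  obtain B where B: "0 \<le> B"
    "\<And>m n. 1 \<le> m \<Longrightarrow> 1 \<le> n \<Longrightarrow> d (Y (n * m)) (pw (Y m) n) \<le> real n * (B * \<phi> m)"
    using qlin_multiple[OF adm Y] by blast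
  \<comment> \<open>Here \<open>m\<close> stays fixed while \<open>n\<close> tends to infinity; only
    afterwards is \<open>m\<close> sent to infinity.\<close>
  have main: "lim_dist d X Y \<le> (A + B) * (\<phi> m / real m) + kap (X m) (Y m) / real m" if m: "1 \<le> m" for m
  proof -
    have "strict_mono (\<lambda>n. n * m)" using m by (simp add: strict_mono_def)
    then have t1: "(\<lambda>n. d (X (n * m)) (Y (n * m)) / real (n * m)) \<longlonglongrightarrow> lim_dist d X Y"
      using LIMSEQ_subseq_LIMSEQ[OF td, of "\<lambda>n. n * m"] by (simp add: comp_def)
    have t2: "(\<lambda>n. (A + B) * (\<phi> m / real m) + d (pw (X m) n) (pw (Y m) n) / real n / real m)
        \<longlonglongrightarrow> (A + B) * (\<phi> m / real m) + kap (X m) (Y m) / real m"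
      using m by (intro tendsto_intros kap_tendsto) auto
    have "d (X (n * m)) (Y (n * m)) / real (n * m) \<le>
        (A + B) * (\<phi> m / real m) + d (pw (X m) n) (pw (Y m) n) / real n / real m" if n: "1 \<le> n" for n
    proof -
      let ?x = "pw (X m) n" and ?y = "pw (Y m) n"
      have "d (X (n * m)) (Y (n * m)) \<le> d (X (n * m)) ?x + d ?x (Y (n * m))"
        by (rule tri) auto
      also have "d ?x (Y (n * m)) \<le> d ?x ?y + d ?y (Y (n * m))"
        by (rule tri) auto
      also have "d ?y (Y (n * m)) = d (Y (n * m)) ?y" by (rule sym) auto
      finally have "d (X (n * m)) (Y (n * m)) \<le> real n * ((A + B) * \<phi> m) + d ?x ?y"
        using A(2)[OF m n] B(2)[OF m n] by (simp add: algebra_simps)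
      then have "d (X (n * m)) (Y (n * m)) / real (n * m) \<le> (real n * ((A + B) * \<phi> m) + d ?x ?y) / real (n * m)"
        by (rule divide_right_mono) simp
      also have "\<dots> = (A + B) * (\<phi> m / real m) + d ?x ?y / real n / real m"
        using m n by (simp add: add_divide_distrib mult.commute[of m n])
      finally show ?thesis .
    qed
    then show ?thesis
      by (intro LIMSEQ_le[OF t1 t2]) blast
  qed
  have "(\<lambda>m. (A + B) * (\<phi> m / real m) + kap (X m) (Y m) / real m) \<longlonglongrightarrow> (A + B) * 0 + lim_dist kap X Y"
    by (intro tendsto_intros dyadic_admissible_sublinear[OF adm] tk)
  then show "lim_dist d X Y \<le> lim_dist kap X Y"
    using LIMSEQ_le_const main by auto
qed

end

subsection \<open>Approximate roots and completeness\<close>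

definition bin_ent :: "real \<Rightarrow> real" where
  "bin_ent a = - (a * ln a) - (1 - a) * ln (1 - a)"

text \<open>The left side equals \<open>ln m + (m - 1) * ln (m / (m - 1))\<close>, and the second
  summand is at most 1. Up to the factor \<open>g\<close> this is the price of an
  \<open>m\<close>-th root.\<close>

lemma bin_ent_inverse_le:
  assumes "2 \<le> m"
  shows "real m * bin_ent (1 / real m) \<le> 1 + ln (real m)"
proof -
  define q where "q = real m - 1"
  have q: "1 \<le> q" and m: "real m = 1 + q" using assms by (auto simp: q_def)
  have eqs: "1 - 1 / (1 + q) = q / (1 + q)" "ln (1 / (1 + q)) = - ln (1 + q)" "ln (q / (1 + q)) = ln q - ln (1 + q)"
    using q by (simp_all add: field_simps ln_div)
  have "bin_ent (1 / (1 + q)) = (ln (1 + q) + q * (ln (1 + q) - ln q)) / (1 + q)"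
    unfolding bin_ent_def eqs by (simp add: add_divide_distrib diff_divide_distrib right_diff_distrib)
  then have "real m * bin_ent (1 / real m) = ln (1 + q) + q * (ln (1 + q) - ln q)"
    unfolding m using q by simp
  also have "ln (1 + q) - ln q = ln ((1 + q) / q)"
    using q by (simp add: ln_div)
  also have "(1 + q) / q = 1 + 1 / q" using q by (simp add: field_simps)
  also have "ln (1 + 1 / q) \<le> 1 / q" using q by (intro ln_add_one_self_le_self) auto
  finally show ?thesis using q m by (simp add: mult_left_mono)
qed

text \<open>Replaces the mean absolute deviation of a binomial variable by its second moment, which
  obeys an exact recursion. The free parameter \<open>s\<close> is later the square root of the
  expected number of copies.\<close>

lemma abs_le_quadratic:
  fixes s t :: real
  assumes "0 < s"
  shows "\<bar>t\<bar> \<le> (t\<^sup>2 + s\<^sup>2) / (2 * s)"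
proof -
  have "0 \<le> (\<bar>t\<bar> - s)\<^sup>2" by simp
  then have "2 * (\<bar>t\<bar> * s) \<le> t\<^sup>2 + s\<^sup>2" by (simp add: power2_diff)
  then show ?thesis using assms by (simp add: field_simps)
qed

text \<open>The mixing axiom is the trace left on distances by the mixture \<open>z\<close> of \<open>x\<close> with weight \<open>a\<close> and
  the unit with weight \<open>1 - a\<close>.\<close>

locale mixing_metric_monoid = metric_monoid +
  fixes g :: real
  assumes mixing: "x \<in> P \<Longrightarrow> 0 < a \<Longrightarrow> a < 1 \<Longrightarrow> \<exists>z\<in>P. \<forall>w\<in>P. \<forall>y\<in>P.
      d (ten z w) y \<le> g * bin_ent a + a * d (ten x w) y + (1 - a) * d w y"
begin

text \<open>\<open>z\<^sup>n\<close> behaves like \<open>x\<^sup>N\<close> with \<open>N\<close> binomial with parameters \<open>n\<close> and \<open>a\<close>; the quadratic term is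
  the second moment of \<open>j + N - K\<close>.\<close>

lemma mixing_power:
  assumes x [simp]: "x \<in> P" and z [simp]: "z \<in> P" and "0 < a" "a < 1" "0 < s"
    and mix: "\<And>w y. w \<in> P \<Longrightarrow> y \<in> P \<Longrightarrow>
      d (ten z w) y \<le> g * bin_ent a + a * d (ten x w) y + (1 - a) * d w y"
  shows "d (ten (pw z n) (pw x j)) (pw x K) \<le> real n * (g * bin_ent a) +
    d x u * (((real j + real n * a - real K)\<^sup>2 + real n * (a * (1 - a)) + s\<^sup>2) / (2 * s))"
proof (induction n arbitrary: j)
  case 0
  have "d (ten (pw z 0) (pw x j)) (pw x K) = d (pw x j) (pw x K)"
    by (rule dist_cong) (auto intro: unit)
  also have "\<dots> \<le> \<bar>real j - real K\<bar> * d x u" by (rule pw_diff) simp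
  also have "\<dots> \<le> (((real j - real K)\<^sup>2 + s\<^sup>2) / (2 * s)) * d x u"
    by (intro mult_right_mono abs_le_quadratic nonneg) (use \<open>0 < s\<close> in auto)
  finally show ?case by (simp add: mult.commute)
next
  case (Suc n)
  define Q where "Q = (\<lambda>n j. ((real j + real n * a - real K)\<^sup>2 + real n * (a * (1 - a)) + s\<^sup>2) / (2 * s))"
  \<comment> \<open>Conditioning on one trial: with probability \<open>a\<close> the exponent
    \<open>j\<close> grows by 1, so the mean moves by \<open>a\<close> and the variance by
    \<open>a * (1 - a)\<close>.\<close>
  have Q: "Q (Suc n) j = a * Q n (Suc j) + (1 - a) * Q n j"
    using \<open>0 < s\<close> unfolding Q_def by (simp add: field_simps power2_eq_square)
  let ?w = "ten (pw z n) (pw x j)" and ?y = "pw x K"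
  have "d (ten (pw z (Suc n)) (pw x j)) ?y = d (ten z ?w) ?y"
    by (rule dist_cong) (auto intro: assoc)
  also have "\<dots> \<le> g * bin_ent a + a * d (ten x ?w) ?y + (1 - a) * d ?w ?y"
    by (rule mix) auto
  also have "d (ten x ?w) ?y = d (ten (pw z n) (pw x (Suc j))) ?y"
    by (rule dist_cong) (auto intro: left_comm)
  also have "a * \<dots> \<le> a * (real n * (g * bin_ent a) + d x u * Q n (Suc j))"
    using Suc.IH[of "Suc j"] \<open>0 < a\<close> unfolding Q_def by (intro mult_left_mono) auto
  also have "(1 - a) * d ?w ?y \<le> (1 - a) * (real n * (g * bin_ent a) + d x u * Q n j)"
    using Suc.IH[of j] \<open>a < 1\<close> unfolding Q_def by (intro mult_left_mono) auto
  finally have "d (ten (pw z (Suc n)) (pw x j)) ?y \<le> real (Suc n) * (g * bin_ent a) + d x u * Q (Suc n) j"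
    unfolding Q by (simp add: algebra_simps)
  then show ?case unfolding Q_def .
qed

text \<open>The \<open>K * m\<close>-th power of the mixture of weight \<open>1 / m\<close> contains
  \<open>K\<close> copies of \<open>x\<close> on average, with variance at most \<open>K\<close>.
  Taking \<open>s = sqrt K\<close> bounds the mean deviation by \<open>sqrt K\<close>, so that only
  the mixing term survives division by \<open>K\<close>.\<close>

lemma approximate_root:
  assumes x [simp]: "x \<in> P" and m: "2 \<le> m"
  obtains z where "z \<in> P" "kap (pw z m) x \<le> real m * (g * bin_ent (1 / real m))"
proof -
  define a where "a = 1 / real m"
  have a: "0 < a" "a < 1" and ma: "real m * a = 1" using m by (auto simp: a_def)
  obtain z where z [simp]: "z \<in> P" and mix: "\<And>w y. w \<in> P \<Longrightarrow> y \<in> P \<Longrightarrow>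
      d (ten z w) y \<le> g * bin_ent a + a * d (ten x w) y + (1 - a) * d w y"
    using mixing[OF x a] by blast
  have le: "d (pw (pw z m) K) (pw x K) / real K \<le> real m * (g * bin_ent a) + d x u / sqrt (real K)"
    if K: "1 \<le> K" for K
  proof -
    define s where "s = sqrt (real K)"
    have s: "0 < s" "s\<^sup>2 = real K" using K by (auto simp: s_def)
    have "d (pw (pw z m) K) (pw x K) = d (ten (pw z (K * m)) (pw x 0)) (pw x K)"
    proof (rule dist_cong)
      show "d (pw (pw z m) K) (ten (pw z (K * m)) (pw x 0)) = 0"
      proof (rule trans0)
        show "d (pw (pw z m) K) (pw z (K * m)) = 0" by (rule sym0[OF pw_mult]) auto
        have "d (ten (pw z (K * m)) u) (pw z (K * m)) = 0"
          by (rule trans0[OF comm unit]) auto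
        then show "d (pw z (K * m)) (ten (pw z (K * m)) (pw x 0)) = 0"
          by (auto intro: sym0)
      qed auto
    qed auto
    also have "\<dots> \<le> real (K * m) * (g * bin_ent a) +
        d x u * (((real 0 + real (K * m) * a - real K)\<^sup>2 + real (K * m) * (a * (1 - a)) + s\<^sup>2) / (2 * s))"
      by (rule mixing_power[OF x z a s(1) mix])
    also have "real (K * m) * a = real K" using ma by simp
    also have "real (K * m) * (a * (1 - a)) = real K * (1 - a)" using ma by simp
    also have "d x u * (((real 0 + real K - real K)\<^sup>2 + real K * (1 - a) + s\<^sup>2) / (2 * s)) \<le> d x u * s"
    proof (rule mult_left_mono)
      have "s\<^sup>2 * (1 - a) \<le> s\<^sup>2" using a by (simp add: mult_left_le)
      then show "((real 0 + real K - real K)\<^sup>2 + real K * (1 - a) + s\<^sup>2) / (2 * s) \<le> s"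
        using s by (simp add: field_simps power2_eq_square)
      show "0 \<le> d x u" by (rule nonneg) auto
    qed
    finally have "d (pw (pw z m) K) (pw x K) / s\<^sup>2 \<le> (s\<^sup>2 * (real m * (g * bin_ent a)) + d x u * s) / s\<^sup>2"
      unfolding s(2) by (intro divide_right_mono) (auto simp: mult_ac)
    also have "\<dots> = real m * (g * bin_ent a) + d x u / s"
      using s(1) by (simp add: field_simps power2_eq_square)
    finally show ?thesis unfolding s(2) by (simp add: s_def)
  qed
  have "(\<lambda>K. real m * (g * bin_ent a) + d x u / sqrt (real K)) \<longlonglongrightarrow> real m * (g * bin_ent a) + 0"
    by (intro tendsto_intros tendsto_divide_0[OF tendsto_const] filterlim_at_top_imp_at_infinity
      filterlim_compose[OF sqrt_at_top] filterlim_real_sequentially)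
  then have "kap (pw z m) x \<le> real m * (g * bin_ent a) + 0"
    using le by (intro LIMSEQ_le[OF kap_tendsto]) auto
  then show ?thesis using that[of z] by (simp add: a_def)
qed

text \<open>An approximate \<open>m\<close>-th root of \<open>X m\<close> has logarithmic defect, hence approximates \<open>X\<close> well for large \<open>m\<close>.\<close>

lemma powers_dense:
  assumes "0 \<le> g" and adm: "dyadic_admissible \<phi> D" and X: "X \<in> qlin P ten kap \<phi>" and "0 < e"
  obtains z where "z \<in> P" "lim_dist kap (pw z) X < e"
proof -
  interpret K: metric_monoid P ten u kap by (rule kap_metric_monoid)
  note [simp] = qlin_closed[OF X]
  obtain C where C: "0 \<le> C"
    "\<And>m n. 1 \<le> m \<Longrightarrow> 1 \<le> n \<Longrightarrow> kap (X (n * m)) (pw (X m) n) \<le> real n * (C * \<phi> m)"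
    using K.qlin_multiple[OF adm X] by blast
  have "(\<lambda>m. g * (1 / real m + ln (real m) / real m) + C * (\<phi> m / real m)) \<longlonglongrightarrow> g * (0 + 0) + C * 0"
    by (intro tendsto_intros dyadic_admissible_sublinear[OF adm] lim_1_over_n
      filterlim_compose[OF lim_ln_over_n] lim_ln_over_n)
  then have "\<forall>\<^sub>F m in sequentially. g * (1 / real m + ln (real m) / real m) + C * (\<phi> m / real m) < e"
    using \<open>0 < e\<close> by (intro order_tendstoD) auto
  then have "\<forall>\<^sub>F m in sequentially. 2 \<le> m \<and> g * (1 / real m + ln (real m) / real m) + C * (\<phi> m / real m) < e"
    using eventually_ge_at_top[of 2] by eventually_elim auto
  then obtain m where m: "2 \<le> m" and small: "g * (1 / real m + ln (real m) / real m) + C * (\<phi> m / real m) < e"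
    unfolding eventually_sequentially by auto
  obtain z where z [simp]: "z \<in> P" and zm: "kap (pw z m) (X m) \<le> real m * (g * bin_ent (1 / real m))"
    using approximate_root[of "X m" m] m by auto
  have "g * (real m * bin_ent (1 / real m)) \<le> g * (1 + ln (real m))"
    using bin_ent_inverse_le[OF m] \<open>0 \<le> g\<close> by (rule mult_left_mono)
  then have zm': "kap (pw z m) (X m) \<le> g * (1 + ln (real m))" using zm by (simp add: mult_ac)
  have pz: "pw z \<in> qlin P ten kap \<phi>" by (rule K.pw_in_qlin[OF z])
  have sm: "strict_mono (\<lambda>n. n * m)" using m by (simp add: strict_mono_def)
  have t: "(\<lambda>n. kap (pw z (n * m)) (X (n * m)) / real (n * m)) \<longlonglongrightarrow> lim_dist kap (pw z) X"
    using LIMSEQ_subseq_LIMSEQ[OF K.lim_dist_tendsto[OF adm pz X] sm] by (simp add: comp_def)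
  have "kap (pw z (n * m)) (X (n * m)) / real (n * m) \<le>
      g * (1 / real m + ln (real m) / real m) + C * (\<phi> m / real m)" if n: "1 \<le> n" for n
  proof -
    have "kap (pw z (n * m)) (X (n * m)) \<le> kap (pw z (n * m)) (pw (X m) n) + kap (pw (X m) n) (X (n * m))"
      by (rule K.tri) auto
    also have "kap (pw z (n * m)) (pw (X m) n) = kap (pw (pw z m) n) (pw (X m) n)"
      by (rule K.dist_cong) (auto intro: K.pw_mult)
    also have "\<dots> \<le> real n * kap (pw z m) (X m)" by (rule K.pw_lip) auto
    also have "\<dots> \<le> real n * (g * (1 + ln (real m)))" by (intro mult_left_mono zm') auto
    also have "kap (pw (X m) n) (X (n * m)) = kap (X (n * m)) (pw (X m) n)" by (rule K.sym) auto
    also have "\<dots> \<le> real n * (C * \<phi> m)" by (rule C(2)) (use m n in auto)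
    finally have "kap (pw z (n * m)) (X (n * m)) / real (n * m) \<le>
        (real n * (g * (1 + ln (real m))) + real n * (C * \<phi> m)) / real (n * m)"
      by (rule divide_right_mono) auto
    also have "\<dots> = g * (1 / real m + ln (real m) / real m) + C * (\<phi> m / real m)"
      using m n by (simp add: field_simps)
    finally show ?thesis .
  qed
  then have "lim_dist kap (pw z) X \<le> g * (1 / real m + ln (real m) / real m) + C * (\<phi> m / real m)"
    by (intro LIMSEQ_le_const2[OF t]) blast
  then show ?thesis using small by (intro that[OF z]) linarith
qed

text \<open>The limit is \<open>n \<mapsto> z\<^sub>i\<^sup>n\<close> with \<open>i = I n\<close> growing so fast that its defect stays bounded by \<open>2\<close>; here
  positivity of \<open>\<phi>\<close> is essential.\<close>

lemma qlin_complete: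
  assumes "0 \<le> g" and adm: "dyadic_admissible \<phi> D" and pos: "0 < \<phi> 1"
    and S: "\<And>n. S n \<in> qlin P ten kap \<phi>"
    and Cauchy: "\<And>e. 0 < e \<Longrightarrow> \<exists>N. \<forall>i\<ge>N. \<forall>j\<ge>N. lim_dist kap (S i) (S j) < e"
  obtains Y where "Y \<in> qlin P ten kap \<phi>" "Y 0 = u" "(\<lambda>n. lim_dist kap (S n) Y) \<longlonglongrightarrow> 0"
proof -
  interpret K: metric_monoid P ten u kap by (rule kap_metric_monoid)
  \<comment> \<open>Each \<open>S n\<close> is replaced by a nearby power sequence. Since power
    sequences are as far apart as their bases, the bases form a Cauchy sequence for
    \<open>kap\<close>.\<close>
  have "\<exists>z. z \<in> P \<and> lim_dist kap (pw z) (S n) < 1 / real (Suc n)" for n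
    using powers_dense[OF \<open>0 \<le> g\<close> adm S[of n], of "1 / real (Suc n)"]
    by (metis of_nat_0_less_iff zero_less_Suc zero_less_divide_1_iff)
  then obtain z where z [simp]: "\<And>n. z n \<in> P" and zS: "\<And>n. lim_dist kap (pw (z n)) (S n) < 1 / real (Suc n)"
    by metis
  have pz: "pw (z n) \<in> qlin P ten kap \<phi>" for n by (rule K.pw_in_qlin[OF z])
  note M = K.lim_dist_pseudo_metric[OF adm]
  have zz: "\<exists>N. \<forall>i\<ge>N. \<forall>j\<ge>N. kap (z i) (z j) < e" if "0 < e" for e
  proof -
    obtain N1 where N1: "\<And>i j. i \<ge> N1 \<Longrightarrow> j \<ge> N1 \<Longrightarrow> lim_dist kap (S i) (S j) < e / 3"
      using Cauchy[of "e / 3"] \<open>0 < e\<close> by auto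
    obtain N2 where N2: "1 / real (Suc N2) < e / 3"
      using nat_approx_posE[of "e / 3"] \<open>0 < e\<close> by auto
    have near: "lim_dist kap (pw (z i)) (S i) < e / 3" if "N2 \<le> i" for i
    proof -
      have "1 / real (Suc i) \<le> 1 / real (Suc N2)" using that by (simp add: field_simps)
      then show ?thesis using zS[of i] N2 by linarith
    qed
    have "kap (z i) (z j) < e" if "max N1 N2 \<le> i" "max N1 N2 \<le> j" for i j
    proof -
      have "kap (z i) (z j) = lim_dist kap (pw (z i)) (pw (z j))"
        by (simp add: lim_dist_kap_pw)
      also have "\<dots> \<le> lim_dist kap (pw (z i)) (S i) + lim_dist kap (S i) (pw (z j))"
        by (rule M(4)[OF pz S pz])
      also have "lim_dist kap (S i) (pw (z j)) \<le> lim_dist kap (S i) (S j) + lim_dist kap (S j) (pw (z j))"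
        by (rule M(4)[OF S S pz])
      also have "lim_dist kap (S j) (pw (z j)) = lim_dist kap (pw (z j)) (S j)"
        by (rule M(3)[OF S pz S])
      finally show ?thesis using near[of i] near[of j] N1[of i j] that by simp
    qed
    then show ?thesis by blast
  qed
  then have "\<forall>n. \<exists>N. \<forall>i\<ge>N. \<forall>j\<ge>N. kap (z i) (z j) < 1 / real (Suc n)" by simp
  then obtain N where N: "\<And>n i j. N n \<le> i \<Longrightarrow> N n \<le> j \<Longrightarrow> kap (z i) (z j) < 1 / real (Suc n)"
    by metis
  \<comment> \<open>Summing the thresholds makes \<open>I n\<close> at least \<open>N m\<close> for
    all \<open>m \<le> n\<close> at once.\<close>
  define I where "I = (\<lambda>n. \<Sum>k\<le>n. N k)"
  have I: "N m \<le> I n" if "m \<le> n" for m n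
    unfolding I_def using that by (intro member_le_sum) auto
  define Y where "Y = (\<lambda>n. pw (z (I n)) n)"
  have YP [simp]: "Y n \<in> P" for n by (simp add: Y_def)
  \<comment> \<open>Both indices are at least \<open>N p\<close>, so the bases differ by less than
    \<open>1 / (p + 1)\<close> and \<open>p\<close> copies of them by at most 1.\<close>
  have step: "real p * kap (z (I (p + q))) (z (I p)) \<le> 1" for p q
  proof -
    have "kap (z (I (p + q))) (z (I p)) < 1 / real (Suc p)" by (rule N) (auto intro: I)
    then have "real p * kap (z (I (p + q))) (z (I p)) \<le> real p * (1 / real (Suc p))"
      by (intro mult_left_mono) auto
    also have "\<dots> \<le> 1" by simp
    finally show ?thesis .
  qed
  have "kap (Y (p + q)) (ten (Y p) (Y q)) \<le> 2 / \<phi> 1 * \<phi> (p + q)" if pq: "1 \<le> p" "1 \<le> q" for p q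
  proof -
    let ?z = "z (I (p + q))"
    have "kap (Y (p + q)) (ten (Y p) (Y q)) = kap (ten (pw ?z p) (pw ?z q)) (ten (Y p) (Y q))"
      by (rule K.dist_cong) (auto simp: Y_def intro: K.pw_add)
    also have "\<dots> \<le> kap (pw ?z p) (Y p) + kap (pw ?z q) (Y q)" by (rule K.lip) auto
    also have "kap (pw ?z p) (Y p) \<le> real p * kap ?z (z (I p))"
      unfolding Y_def by (rule K.pw_lip) auto
    also have "kap (pw ?z q) (Y q) \<le> real q * kap ?z (z (I q))"
      unfolding Y_def by (rule K.pw_lip) auto
    also have "real p * kap ?z (z (I p)) \<le> 1" by (rule step)
    also have "real q * kap ?z (z (I q)) \<le> 1" using step[of q p] by (simp add: add.commute)
    also have "1 + 1 \<le> 2 / \<phi> 1 * \<phi> (p + q)"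
      using dyadic_admissibleD(2)[OF adm, of 1 "p + q"] pq pos by (simp add: field_simps)
    finally show ?thesis by simp
  qed
  then have Y: "Y \<in> qlin P ten kap \<phi>"
    unfolding qlin_def using pos by (auto intro!: exI[of _ "2 / \<phi> 1"])
  have zY: "lim_dist kap (pw (z j)) Y \<le> 1 / real (Suc m)" if j: "N m \<le> j" for j m
  proof (rule LIMSEQ_le_const2[OF K.lim_dist_tendsto[OF adm pz Y]], intro exI allI impI)
    fix n assume n: "max 1 m \<le> n"
    have "kap (pw (z j) n) (Y n) \<le> real n * kap (z j) (z (I n))"
      unfolding Y_def by (rule K.pw_lip) auto
    also have "\<dots> \<le> real n * (1 / real (Suc m))"
      using N[OF j, of "I n"] I[of m n] n by (intro mult_left_mono) auto
    finally show "kap (pw (z j) n) (Y n) / real n \<le> 1 / real (Suc m)"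
      using n by (simp add: field_simps)
  qed
  have "(\<lambda>n. lim_dist kap (S n) Y) \<longlonglongrightarrow> 0"
  proof (rule LIMSEQ_I)
    fix e :: real assume "0 < e"
    obtain m where m: "1 / real (Suc m) < e / 2"
      using nat_approx_posE[of "e / 2"] \<open>0 < e\<close> by auto
    have "norm (lim_dist kap (S n) Y - 0) < e" if n: "max m (N m) \<le> n" for n
    proof -
      have "lim_dist kap (S n) Y \<le> lim_dist kap (S n) (pw (z n)) + lim_dist kap (pw (z n)) Y"
        by (rule M(4)[OF S pz Y])
      also have "lim_dist kap (S n) (pw (z n)) = lim_dist kap (pw (z n)) (S n)"
        by (rule M(3)[OF S pz S])
      also have "\<dots> < 1 / real (Suc n)" by (rule zS)
      also have "\<dots> \<le> 1 / real (Suc m)" using n by (simp add: field_simps)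
      also have "lim_dist kap (pw (z n)) Y \<le> 1 / real (Suc m)" using zY n by simp
      finally show ?thesis using m M(1)[OF S[of n] Y Y] by simp
    qed
    then show "\<exists>n0. \<forall>n\<ge>n0. norm (lim_dist kap (S n) Y - 0) < e" by blast
  qed
  then show ?thesis using that Y by (simp add: Y_def)
qed

end

section \<open>Entropy\<close>

text \<open>Polymorphic, because couplings and mixtures are treated on product and sum types before
  they are encoded by numbers.\<close>

definition entropy :: "'a pmf \<Rightarrow> real" where
  "entropy p = - (\<Sum>x\<in>set_pmf p. pmf p x * ln (pmf p x))"

lemma Ent_eq_entropy: "Ent p = entropy p"
  by (simp add: Ent_def entropy_def)

section \<open>Entropy of images, products and couplings\<close>

lemma pmf_map_sum:
  assumes "finite (set_pmf p)"
  shows "pmf (map_pmf f p) y = (\<Sum>x\<in>{x \<in> set_pmf p. f x = y}. pmf p x)"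
proof -
  have "pmf (map_pmf f p) y = measure p (f -` {y} \<inter> set_pmf p)"
    by (simp add: pmf_map measure_Int_set_pmf)
  also have "f -` {y} \<inter> set_pmf p = {x \<in> set_pmf p. f x = y}" by auto
  finally show ?thesis using assms by (simp add: measure_measure_pmf_finite)
qed

lemma pmf_le_pmf_map: "pmf p x \<le> pmf (map_pmf f p) (f x)"
proof -
  have "pmf p x = measure p {x}" by (simp add: measure_pmf_single)
  also have "\<dots> \<le> measure p (f -` {f x})" by (rule measure_pmf.finite_measure_mono) auto
  finally show ?thesis by (simp add: pmf_map)
qed

text \<open>Grouping by fibres of \<open>f\<close> moves the sum to the source, so that the
  entropies of several images of \<open>p\<close> can be compared term by term.\<close>

lemma entropy_map:
  assumes fin: "finite (set_pmf p)"
  shows "entropy (map_pmf f p) = - (\<Sum>x\<in>set_pmf p. pmf p x * ln (pmf (map_pmf f p) (f x)))"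
proof -
  let ?q = "map_pmf f p"
  have "(\<Sum>x\<in>set_pmf p. pmf p x * ln (pmf ?q (f x))) =
      (\<Sum>y\<in>f ` set_pmf p. \<Sum>x\<in>{x \<in> set_pmf p. f x = y}. pmf p x * ln (pmf ?q (f x)))"
    by (rule sum.image_gen[OF fin])
  also have "\<dots> = (\<Sum>y\<in>f ` set_pmf p. pmf ?q y * ln (pmf ?q y))"
    by (intro sum.cong refl) (simp add: pmf_map_sum[OF fin] sum_distrib_right)
  finally show ?thesis by (simp add: entropy_def)
qed

lemma entropy_map_le:
  assumes fin: "finite (set_pmf p)"
  shows "entropy (map_pmf f p) \<le> entropy p"
proof -
  have "(\<Sum>x\<in>set_pmf p. pmf p x * ln (pmf p x)) \<le> (\<Sum>x\<in>set_pmf p. pmf p x * ln (pmf (map_pmf f p) (f x)))"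
  proof (intro sum_mono mult_left_mono)
    fix x assume x: "x \<in> set_pmf p"
    then have "0 < pmf p x" by (rule pmf_positive)
    then show "ln (pmf p x) \<le> ln (pmf (map_pmf f p) (f x))"
      using pmf_le_pmf_map[of p x f] by simp
  qed simp
  then show ?thesis unfolding entropy_map[OF fin] by (simp add: entropy_def)
qed

lemma entropy_map_inj:
  assumes inj: "inj_on f (set_pmf p)" and fin: "finite (set_pmf p)"
  shows "entropy (map_pmf f p) = entropy p"
  unfolding entropy_map[OF fin] by (simp add: entropy_def pmf_map_inj[OF inj] cong: sum.cong)

lemma entropy_return: "entropy (return_pmf x) = 0"
  by (simp add: entropy_def)

lemma entropy_pair:
  assumes p: "finite (set_pmf p)" and q: "finite (set_pmf q)"
  shows "entropy (pair_pmf p q) = entropy p + entropy q"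
proof -
  let ?c = "pair_pmf p q"
  have fin: "finite (set_pmf ?c)" using p q by simp
  have "entropy p + entropy q = entropy (map_pmf fst ?c) + entropy (map_pmf snd ?c)"
    by (simp add: map_fst_pair_pmf map_snd_pair_pmf)
  also have "\<dots> = - (\<Sum>x\<in>set_pmf ?c. pmf ?c x * ln (pmf p (fst x)) + pmf ?c x * ln (pmf q (snd x)))"
    unfolding entropy_map[OF fin] unfolding map_fst_pair_pmf map_snd_pair_pmf by (simp add: sum.distrib)
  also have "\<dots> = - (\<Sum>x\<in>set_pmf ?c. pmf ?c x * ln (pmf ?c x))"
  proof -
    have "pmf ?c x * ln (pmf p (fst x)) + pmf ?c x * ln (pmf q (snd x)) = pmf ?c x * ln (pmf ?c x)"
      if "x \<in> set_pmf ?c" for x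
      using that pmf_positive[of _ p] pmf_positive[of _ q]
      by (cases x) (auto simp: pmf_pair ln_mult distrib_left)
    then show ?thesis by (simp cong: sum.cong)
  qed
  finally show ?thesis by (simp add: entropy_def)
qed

text \<open>Gibbs' inequality applied to \<open>c(a,b)\<close> and \<open>p(a) q(b) / r(f a)\<close>.\<close>

lemma entropy_submodular:
  assumes fin: "finite (set_pmf c)" and fg: "\<And>a b. (a, b) \<in> set_pmf c \<Longrightarrow> f a = g b"
  shows "entropy c + entropy (map_pmf (f \<circ> fst) c) \<le> entropy (map_pmf fst c) + entropy (map_pmf snd c)"
proof -
  let ?S = "set_pmf c"
  define p where "p = map_pmf fst c"
  define q where "q = map_pmf snd c"
  define r where "r = map_pmf (f \<circ> fst) c"
  have finp: "finite (set_pmf p)" and finq: "finite (set_pmf q)"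
    using fin by (auto simp: p_def q_def)
  have r_eq: "r = map_pmf g q"
    unfolding r_def q_def map_pmf_comp using fg by (intro map_pmf_cong) auto
  let ?t = "\<lambda>x. pmf p (fst x) * pmf q (snd x) / pmf r (f (fst x))"
  have le: "pmf c x * ln (pmf p (fst x)) + pmf c x * ln (pmf q (snd x))
      - pmf c x * ln (pmf c x) - pmf c x * ln (pmf r (f (fst x))) \<le> ?t x - pmf c x" if x: "x \<in> ?S" for x
  proof -
    have pos: "0 < pmf c x" "0 < pmf p (fst x)" "0 < pmf q (snd x)" "0 < pmf r (f (fst x))"
      using x by (auto intro!: pmf_positive simp: p_def q_def r_def)
    have "ln (?t x / pmf c x) \<le> ?t x / pmf c x - 1"
      using pos by (intro ln_le_minus_one) auto
    then have "pmf c x * ln (?t x / pmf c x) \<le> pmf c x * (?t x / pmf c x - 1)"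
      using pos by (intro mult_left_mono) auto
    also have "\<dots> = ?t x - pmf c x" using pos by (simp add: field_simps)
    also have "ln (?t x / pmf c x) = ln (pmf p (fst x)) + ln (pmf q (snd x)) - ln (pmf r (f (fst x))) - ln (pmf c x)"
      using pos by (simp add: ln_mult ln_div)
    finally show ?thesis by (simp add: algebra_simps)
  qed
  \<comment> \<open>The values of \<open>?t\<close> are the weights of the conditionally independent
    coupling. Passing from the support of \<open>c\<close> to the full fibre product can only add
    mass, and there the total is 1.\<close>
  let ?B = "\<lambda>a. {b \<in> set_pmf q. g b = f a}"
  have "(\<Sum>x\<in>?S. ?t x) \<le> (\<Sum>x\<in>Sigma (set_pmf p) ?B. ?t x)"
  proof (rule sum_mono2)
    show "finite (Sigma (set_pmf p) ?B)" using finp finq by auto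
    show "?S \<subseteq> Sigma (set_pmf p) ?B" using fg by (force simp: p_def q_def)
  qed simp
  also have "\<dots> = (\<Sum>a\<in>set_pmf p. \<Sum>b\<in>?B a. pmf p a * pmf q b / pmf r (f a))"
    using finp finq by (subst sum.Sigma) (auto simp: case_prod_beta)
  also have "\<dots> = (\<Sum>a\<in>set_pmf p. pmf p a)"
  proof (intro sum.cong refl)
    fix a assume a: "a \<in> set_pmf p"
    have "f a \<in> set_pmf r" using a by (auto simp: p_def r_def)
    then have "0 < pmf r (f a)" by (rule pmf_positive)
    moreover have "(\<Sum>b\<in>?B a. pmf q b) = pmf r (f a)"
      unfolding r_eq pmf_map_sum[OF finq] ..
    ultimately show "(\<Sum>b\<in>?B a. pmf p a * pmf q b / pmf r (f a)) = pmf p a"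
      by (simp add: sum_divide_distrib[symmetric] sum_distrib_left[symmetric])
  qed
  also have "\<dots> = 1" by (rule sum_pmf_eq_1[OF finp]) simp
  also have "1 = (\<Sum>x\<in>?S. pmf c x)" by (rule sum_pmf_eq_1[OF fin, symmetric]) simp
  finally have "(\<Sum>x\<in>?S. ?t x - pmf c x) \<le> 0" by (simp add: sum_subtractf)
  moreover have "(\<Sum>x\<in>?S. pmf c x * ln (pmf p (fst x)) + pmf c x * ln (pmf q (snd x))
      - pmf c x * ln (pmf c x) - pmf c x * ln (pmf r (f (fst x)))) \<le> (\<Sum>x\<in>?S. ?t x - pmf c x)"
    by (intro sum_mono le)
  ultimately show ?thesis
    unfolding entropy_map[OF fin] entropy_def[of c]
    by (simp add: sum.distrib sum_subtractf p_def q_def r_def)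
qed

text \<open>The disjoint sum keeps the mixing variable visible as the tag \<open>Inl\<close> or
  \<open>Inr\<close>; a map such as \<open>case_sum\<close> can forget it.\<close>

definition mixture :: "real \<Rightarrow> 'a pmf \<Rightarrow> 'b pmf \<Rightarrow> ('a + 'b) pmf" where
  "mixture a p q = bernoulli_pmf a \<bind> (\<lambda>b. if b then map_pmf Inl p else map_pmf Inr q)"

lemma map_mixture: "map_pmf f (mixture a p q) =
    bernoulli_pmf a \<bind> (\<lambda>b. if b then map_pmf (f \<circ> Inl) p else map_pmf (f \<circ> Inr) q)"
  unfolding mixture_def map_bind_pmf
  by (intro bind_pmf_cong refl) (simp add: map_pmf_comp comp_def)

lemma map_sum_mixture: "map_pmf (map_sum f g) (mixture a p q) = mixture a (map_pmf f p) (map_pmf g q)"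
  unfolding map_mixture unfolding mixture_def
  by (intro bind_pmf_cong refl) (simp add: map_pmf_comp comp_def)

lemma map_case_sum_mixture:
  assumes "map_pmf f p = r" "map_pmf g q = r"
  shows "map_pmf (case_sum f g) (mixture a p q) = r"
  unfolding map_mixture using assms by (simp add: comp_def cong: if_cong)

lemma set_mixture:
  assumes "0 < a" "a < 1"
  shows "set_pmf (mixture a p q) = Inl ` set_pmf p \<union> Inr ` set_pmf q"
  using assms by (auto simp: mixture_def set_pmf_bernoulli split: if_splits)

lemma pmf_mixture:
  assumes "0 < a" "a < 1"
  shows "pmf (mixture a p q) (Inl x) = a * pmf p x" "pmf (mixture a p q) (Inr y) = (1 - a) * pmf q y"
proof -
  have 1: "pmf (map_pmf Inl p) (Inl x) = pmf p x" and 2: "pmf (map_pmf Inr q) (Inr y) = pmf q y"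
    by (simp_all add: pmf_map_inj')
  have 3: "pmf (map_pmf Inr q) (Inl x) = 0" and 4: "pmf (map_pmf Inl p) (Inr y) = 0"
    by (rule pmf_map_outside, auto)+
  show "pmf (mixture a p q) (Inl x) = a * pmf p x" "pmf (mixture a p q) (Inr y) = (1 - a) * pmf q y"
    using assms unfolding mixture_def pmf_bind by (simp_all add: 1 2 3 4)
qed

text \<open>Chain rule for the tag: its own entropy plus the average of the entropies given its
  value. The auxiliary fact \<open>*\<close> treats one branch, with all masses scaled by its
  weight.\<close>

lemma entropy_mixture:
  assumes a: "0 < a" "a < 1" and p: "finite (set_pmf p)" and q: "finite (set_pmf q)"
  shows "entropy (mixture a p q) = bin_ent a + a * entropy p + (1 - a) * entropy q"
proof -
  have *: "(\<Sum>x\<in>set_pmf p. (t * pmf p x) * ln (t * pmf p x)) = t * ln t - t * entropy p"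
    if t: "0 < t" and fin: "finite (set_pmf p)" for t and p :: "'z pmf"
  proof -
    have "(\<Sum>x\<in>set_pmf p. (t * pmf p x) * ln (t * pmf p x)) =
        (\<Sum>x\<in>set_pmf p. t * ln t * pmf p x + t * (pmf p x * ln (pmf p x)))"
      using t pmf_positive[of _ p] by (intro sum.cong refl) (simp add: ln_mult algebra_simps)
    also have "\<dots> = t * ln t * (\<Sum>x\<in>set_pmf p. pmf p x) + t * (\<Sum>x\<in>set_pmf p. pmf p x * ln (pmf p x))"
      by (simp add: sum.distrib sum_distrib_left)
    also have "(\<Sum>x\<in>set_pmf p. pmf p x) = 1" by (rule sum_pmf_eq_1[OF fin]) simp
    finally show ?thesis by (simp add: entropy_def)
  qed
  have "entropy (mixture a p q) =
      - (\<Sum>x\<in>set_pmf p. (a * pmf p x) * ln (a * pmf p x))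
      - (\<Sum>x\<in>set_pmf q. ((1 - a) * pmf q x) * ln ((1 - a) * pmf q x))"
    unfolding entropy_def set_mixture[OF a] using p q
    by (subst sum.union_disjoint) (auto simp: sum.reindex pmf_mixture[OF a])
  then show ?thesis
    using *[OF _ p, of a] *[OF _ q, of "1 - a"] a by (simp add: bin_ent_def)
qed

section \<open>Diagrams\<close>

lemma red_eq_iff: "red_eq p f g \<longleftrightarrow> (\<forall>x\<in>set_pmf p. f x = g x)"
  by (simp add: red_eq_def AE_measure_pmf_iff)

lemma ProbI:
  assumes "\<And>i. i \<in> Field G \<Longrightarrow> finite (set_pmf (space_at X i))"
    and "\<And>i j. (i, j) \<in> G \<Longrightarrow> map_pmf (red_at X i j) (space_at X i) = space_at X j"
    and "\<And>i x. i \<in> Field G \<Longrightarrow> x \<in> set_pmf (space_at X i) \<Longrightarrow> red_at X i i x = x"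
    and "\<And>i j k x. (i, j) \<in> G \<Longrightarrow> (j, k) \<in> G \<Longrightarrow> x \<in> set_pmf (space_at X i) \<Longrightarrow>
      red_at X j k (red_at X i j x) = red_at X i k x"
  shows "X \<in> Prob G"
  using assms unfolding Prob_def finite_prob_space_def reduction_def red_eq_iff by auto

lemma ProbD:
  assumes "X \<in> Prob G"
  shows "i \<in> Field G \<Longrightarrow> finite (set_pmf (space_at X i))"
    and "(i, j) \<in> G \<Longrightarrow> map_pmf (red_at X i j) (space_at X i) = space_at X j"
    and "i \<in> Field G \<Longrightarrow> x \<in> set_pmf (space_at X i) \<Longrightarrow> red_at X i i x = x"
    and "(i, j) \<in> G \<Longrightarrow> (j, k) \<in> G \<Longrightarrow> x \<in> set_pmf (space_at X i) \<Longrightarrow>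
      red_at X j k (red_at X i j x) = red_at X i k x"
  using assms unfolding Prob_def finite_prob_space_def reduction_def red_eq_iff by auto

lemma diagram_morphismI:
  assumes "\<And>i. i \<in> Field G \<Longrightarrow> map_pmf (a i) (space_at X i) = space_at Y i"
    and "\<And>i j x. (i, j) \<in> G \<Longrightarrow> x \<in> set_pmf (space_at X i) \<Longrightarrow>
      red_at Y i j (a i x) = a j (red_at X i j x)"
  shows "diagram_morphism G X Y a"
  using assms unfolding diagram_morphism_def reduction_def red_eq_iff by auto

lemma diagram_morphismD:
  assumes "diagram_morphism G X Y a"
  shows "i \<in> Field G \<Longrightarrow> map_pmf (a i) (space_at X i) = space_at Y i"
    and "(i, j) \<in> G \<Longrightarrow> x \<in> set_pmf (space_at X i) \<Longrightarrow>
      red_at Y i j (a i x) = a j (red_at X i j x)"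
  using assms unfolding diagram_morphism_def reduction_def red_eq_iff by auto

lemma diagram_morphism_in_set:
  assumes "diagram_morphism G X Y a" "i \<in> Field G" "x \<in> set_pmf (space_at X i)"
  shows "a i x \<in> set_pmf (space_at Y i)"
  using assms(3) by (simp flip: diagram_morphismD(1)[OF assms(1,2)])

lemma diagram_morphism_id: "diagram_morphism G X X (\<lambda>_. id)"
  by (rule diagram_morphismI) auto

lemma diagram_morphism_comp:
  assumes a: "diagram_morphism G X Y a" and b: "diagram_morphism G Y Z b"
  shows "diagram_morphism G X Z (\<lambda>i. b i \<circ> a i)"
proof (rule diagram_morphismI)
  show "map_pmf (b i \<circ> a i) (space_at X i) = space_at Z i" if "i \<in> Field G" for i
    using diagram_morphismD(1)[OF a that] diagram_morphismD(1)[OF b that]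
    by (metis map_pmf_compose comp_apply)
  show "red_at Z i j ((b i \<circ> a i) x) = (b j \<circ> a j) (red_at X i j x)"
    if "(i, j) \<in> G" "x \<in> set_pmf (space_at X i)" for i j x
    using that diagram_morphismD(2)[OF a that]
      diagram_morphismD(2)[OF b that(1) diagram_morphism_in_set[OF a FieldI1[OF that(1)] that(2)]]
    by simp
qed

lemma ent_vec_morphism_le:
  assumes "X \<in> Prob G" "diagram_morphism G X Y a" "i \<in> Field G"
  shows "ent_vec Y i \<le> ent_vec X i"
  using entropy_map_le[OF ProbD(1)[OF assms(1,3)], of "a i"] diagram_morphismD(1)[OF assms(2,3)]
  by (simp add: ent_vec_def Ent_eq_entropy)

lemma unit_diagram_in_Prob: "unit_diagram \<in> Prob G"
  by (rule ProbI) (auto simp: unit_diagram_def)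

lemma ent_vec_unit: "ent_vec unit_diagram i = 0"
  by (simp add: ent_vec_def Ent_eq_entropy unit_diagram_def entropy_return)

subsection \<open>Couplings and tensor products\<close>

text \<open>A common form for the tensor product and for the gluing of two fans: the joint laws
  differ, while the reductions act componentwise in both.\<close>

definition coupled :: "'g diagram \<Rightarrow> 'g diagram \<Rightarrow> ('g \<Rightarrow> (nat \<times> nat) pmf) \<Rightarrow> 'g diagram" where
  "coupled X Y c = \<lparr>
     space_at = (\<lambda>i. map_pmf prod_encode (c i)),
     red_at = (\<lambda>i j z. prod_encode (map_prod (red_at X i j) (red_at Y i j) (prod_decode z))) \<rparr>"

definition coupling :: "('g \<times> 'g) set \<Rightarrow> 'g diagram \<Rightarrow> 'g diagram \<Rightarrow> ('g \<Rightarrow> (nat \<times> nat) pmf) \<Rightarrow> bool" where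
  "coupling G X Y c \<longleftrightarrow>
     (\<forall>i\<in>Field G. map_pmf fst (c i) = space_at X i \<and> map_pmf snd (c i) = space_at Y i) \<and>
     (\<forall>(i, j)\<in>G. map_pmf (map_prod (red_at X i j) (red_at Y i j)) (c i) = c j)"

lemma tensor_eq_coupled: "tensor X Y = coupled X Y (\<lambda>i. pair_pmf (space_at X i) (space_at Y i))"
  by (simp add: tensor_def coupled_def)

lemma map_prod_pair_pmf: "map_pmf (map_prod f g) (pair_pmf p q) = pair_pmf (map_pmf f p) (map_pmf g q)"
  by (simp add: map_prod_def map_pair)

lemma coupling_pair:
  assumes "X \<in> Prob G" "Y \<in> Prob G"
  shows "coupling G X Y (\<lambda>i. pair_pmf (space_at X i) (space_at Y i))"
  using ProbD(2)[OF assms(1)] ProbD(2)[OF assms(2)]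
  by (auto simp: coupling_def map_fst_pair_pmf map_snd_pair_pmf map_prod_pair_pmf)

lemma
  assumes "coupling G X Y c" "i \<in> Field G"
  shows coupling_fst: "map_pmf fst (c i) = space_at X i"
    and coupling_snd: "map_pmf snd (c i) = space_at Y i"
  using assms by (auto simp: coupling_def)

lemma coupling_in_set:
  assumes "coupling G X Y c" "i \<in> Field G" "(x, y) \<in> set_pmf (c i)"
  shows "x \<in> set_pmf (space_at X i)" "y \<in> set_pmf (space_at Y i)"
  using assms(3) by (force simp flip: coupling_fst[OF assms(1,2)] coupling_snd[OF assms(1,2)])+

lemma finite_coupling:
  assumes "X \<in> Prob G" "Y \<in> Prob G" "coupling G X Y c" "i \<in> Field G"
  shows "finite (set_pmf (c i))"
proof (rule finite_subset)
  show "set_pmf (c i) \<subseteq> set_pmf (space_at X i) \<times> set_pmf (space_at Y i)"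
    using coupling_in_set[OF assms(3,4)] by auto
qed (use ProbD(1)[OF assms(1,4)] ProbD(1)[OF assms(2,4)] in simp)

lemma coupled_in_Prob:
  assumes X: "X \<in> Prob G" and Y: "Y \<in> Prob G" and c: "coupling G X Y c"
  shows "coupled X Y c \<in> Prob G"
proof (rule ProbI)
  show "finite (set_pmf (space_at (coupled X Y c) i))" if "i \<in> Field G" for i
    using finite_coupling[OF X Y c that] by (simp add: coupled_def)
  show "map_pmf (red_at (coupled X Y c) i j) (space_at (coupled X Y c) i) = space_at (coupled X Y c) j"
    if "(i, j) \<in> G" for i j
  proof -
    have "c j = map_pmf (map_prod (red_at X i j) (red_at Y i j)) (c i)"
      using c that by (auto simp: coupling_def)
    then show ?thesis by (simp add: coupled_def map_pmf_comp)
  qed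
  show "red_at (coupled X Y c) i i z = z"
    if "i \<in> Field G" "z \<in> set_pmf (space_at (coupled X Y c) i)" for i z
    using that ProbD(3)[OF X] ProbD(3)[OF Y] coupling_in_set[OF c]
    by (auto simp: coupled_def)
  show "red_at (coupled X Y c) j k (red_at (coupled X Y c) i j z) = red_at (coupled X Y c) i k z"
    if ijk: "(i, j) \<in> G" "(j, k) \<in> G" and z: "z \<in> set_pmf (space_at (coupled X Y c) i)" for i j k z
    using z ProbD(4)[OF X ijk] ProbD(4)[OF Y ijk] coupling_in_set[OF c FieldI1[OF ijk(1)]]
    by (auto simp: coupled_def)
qed

lemma
  assumes c: "coupling G X Y c"
  shows coupled_morphism_fst: "diagram_morphism G (coupled X Y c) X (\<lambda>_. fst \<circ> prod_decode)"
    and coupled_morphism_snd: "diagram_morphism G (coupled X Y c) Y (\<lambda>_. snd \<circ> prod_decode)"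
  using coupling_fst[OF c] coupling_snd[OF c]
  by (auto intro!: diagram_morphismI simp: coupled_def map_pmf_comp)

lemma ent_vec_coupled:
  assumes "X \<in> Prob G" "Y \<in> Prob G" "coupling G X Y c" "i \<in> Field G"
  shows "ent_vec (coupled X Y c) i = entropy (c i)"
  unfolding ent_vec_def Ent_eq_entropy coupled_def
  using finite_coupling[OF assms] by (simp add: entropy_map_inj[OF inj_prod_encode])

lemma tensor_in_Prob: "X \<in> Prob G \<Longrightarrow> Y \<in> Prob G \<Longrightarrow> tensor X Y \<in> Prob G"
  unfolding tensor_eq_coupled by (intro coupled_in_Prob coupling_pair)

lemma ent_vec_tensor:
  assumes "X \<in> Prob G" "Y \<in> Prob G" "i \<in> Field G"
  shows "ent_vec (tensor X Y) i = ent_vec X i + ent_vec Y i"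
  unfolding tensor_eq_coupled ent_vec_coupled[OF assms(1,2) coupling_pair[OF assms(1,2)] assms(3)]
  using ProbD(1)[OF assms(1,3)] ProbD(1)[OF assms(2,3)]
  by (simp add: entropy_pair ent_vec_def Ent_eq_entropy)

lemma space_at_tensor: "space_at (tensor X Y) i = map_pmf prod_encode (pair_pmf (space_at X i) (space_at Y i))"
  and red_at_tensor: "red_at (tensor X Y) i j (prod_encode (x, y)) = prod_encode (red_at X i j x, red_at Y i j y)"
  by (simp_all add: tensor_def)

lemma tensor_morphism:
  assumes "diagram_morphism G X X' a" "diagram_morphism G Y Y' b"
  shows "diagram_morphism G (tensor X Y) (tensor X' Y')
    (\<lambda>i z. prod_encode (map_prod (a i) (b i) (prod_decode z)))"
proof (rule diagram_morphismI)
  show "map_pmf (\<lambda>z. prod_encode (map_prod (a i) (b i) (prod_decode z))) (space_at (tensor X Y) i) =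
      space_at (tensor X' Y') i" if "i \<in> Field G" for i
  proof -
    have "space_at (tensor X' Y') i =
        map_pmf prod_encode (map_pmf (map_prod (a i) (b i)) (pair_pmf (space_at X i) (space_at Y i)))"
      unfolding space_at_tensor map_prod_pair_pmf
      using diagram_morphismD(1)[OF assms(1) that] diagram_morphismD(1)[OF assms(2) that] by simp
    then show ?thesis by (simp add: space_at_tensor map_pmf_comp)
  qed
qed (use diagram_morphismD(2)[OF assms(1)] diagram_morphismD(2)[OF assms(2)] in
    \<open>auto simp: space_at_tensor red_at_tensor\<close>)

subsection \<open>Mixtures of diagrams\<close>

text \<open>One mixing variable is shared by all objects, since the reductions respect the tags.
  With \<open>Y = unit_diagram\<close> and \<open>a = 1 / m\<close> this is the approximate
  root.\<close>

definition mix_diagram :: "real \<Rightarrow> 'g diagram \<Rightarrow> 'g diagram \<Rightarrow> 'g diagram" where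
  "mix_diagram a X Y = \<lparr>
     space_at = (\<lambda>i. map_pmf sum_encode (mixture a (space_at X i) (space_at Y i))),
     red_at = (\<lambda>i j z. sum_encode (map_sum (red_at X i j) (red_at Y i j) (sum_decode z))) \<rparr>"

lemma space_at_mix: "space_at (mix_diagram a X Y) i = map_pmf sum_encode (mixture a (space_at X i) (space_at Y i))"
  and red_at_mix: "red_at (mix_diagram a X Y) i j (sum_encode s) =
    sum_encode (map_sum (red_at X i j) (red_at Y i j) s)"
  by (simp_all add: mix_diagram_def)

lemma mix_diagram_morphism:
  assumes "0 < t" "t < 1" and a: "diagram_morphism G X X' a" and b: "diagram_morphism G Y Y' b"
  shows "diagram_morphism G (mix_diagram t X Y) (mix_diagram t X' Y')
    (\<lambda>i z. sum_encode (map_sum (a i) (b i) (sum_decode z)))"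
proof (rule diagram_morphismI)
  show "map_pmf (\<lambda>z. sum_encode (map_sum (a i) (b i) (sum_decode z))) (space_at (mix_diagram t X Y) i) =
      space_at (mix_diagram t X' Y') i" if "i \<in> Field G" for i
  proof -
    have "space_at (mix_diagram t X' Y') i =
        map_pmf sum_encode (map_pmf (map_sum (a i) (b i)) (mixture t (space_at X i) (space_at Y i)))"
      unfolding space_at_mix map_sum_mixture
      using diagram_morphismD(1)[OF a that] diagram_morphismD(1)[OF b that] by simp
    then show ?thesis by (simp add: space_at_mix map_pmf_comp)
  qed
qed (use diagram_morphismD(2)[OF a] diagram_morphismD(2)[OF b] in
    \<open>auto simp: space_at_mix red_at_mix set_mixture[OF assms(1,2)]\<close>)

text \<open>Here the mixing variable is forgotten, which is possible because both parts reduce to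
  the same diagram.\<close>

lemma mix_diagram_fold_morphism:
  assumes "0 < t" "t < 1" and a: "diagram_morphism G X Z a" and b: "diagram_morphism G Y Z b"
  shows "diagram_morphism G (mix_diagram t X Y) Z (\<lambda>i z. case_sum (a i) (b i) (sum_decode z))"
proof (rule diagram_morphismI)
  show "map_pmf (\<lambda>z. case_sum (a i) (b i) (sum_decode z)) (space_at (mix_diagram t X Y) i) = space_at Z i"
    if "i \<in> Field G" for i
    using map_case_sum_mixture[OF diagram_morphismD(1)[OF a that] diagram_morphismD(1)[OF b that], of t]
    by (simp add: space_at_mix map_pmf_comp)
qed (use diagram_morphismD(2)[OF a] diagram_morphismD(2)[OF b] in
    \<open>auto simp: space_at_mix red_at_mix set_mixture[OF assms(1,2)]\<close>)

lemma mix_diagram_in_Prob: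
  assumes "0 < t" "t < 1" and X: "X \<in> Prob G" and Y: "Y \<in> Prob G"
  shows "mix_diagram t X Y \<in> Prob G"
proof (rule ProbI)
  show "finite (set_pmf (space_at (mix_diagram t X Y) i))" if "i \<in> Field G" for i
    using ProbD(1)[OF X that] ProbD(1)[OF Y that] by (simp add: space_at_mix set_mixture[OF assms(1,2)])
  show "map_pmf (red_at (mix_diagram t X Y) i j) (space_at (mix_diagram t X Y) i) =
      space_at (mix_diagram t X Y) j" if "(i, j) \<in> G" for i j
  proof -
    have "space_at (mix_diagram t X Y) j = map_pmf sum_encode
        (map_pmf (map_sum (red_at X i j) (red_at Y i j)) (mixture t (space_at X i) (space_at Y i)))"
      unfolding space_at_mix map_sum_mixture using ProbD(2)[OF X that] ProbD(2)[OF Y that] by simp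
    then show ?thesis by (simp add: mix_diagram_def map_pmf_comp)
  qed
  show "red_at (mix_diagram t X Y) i i z = z"
    if "i \<in> Field G" "z \<in> set_pmf (space_at (mix_diagram t X Y) i)" for i z
    using that ProbD(3)[OF X] ProbD(3)[OF Y]
    by (auto simp: space_at_mix red_at_mix set_mixture[OF assms(1,2)])
  show "red_at (mix_diagram t X Y) j k (red_at (mix_diagram t X Y) i j z) = red_at (mix_diagram t X Y) i k z"
    if ijk: "(i, j) \<in> G" "(j, k) \<in> G" and z: "z \<in> set_pmf (space_at (mix_diagram t X Y) i)" for i j k z
    using z ProbD(4)[OF X ijk] ProbD(4)[OF Y ijk]
    by (auto simp: space_at_mix red_at_mix set_mixture[OF assms(1,2)])
qed

lemma ent_vec_mix_diagram:
  assumes "0 < t" "t < 1" "X \<in> Prob G" "Y \<in> Prob G" "i \<in> Field G"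
  shows "ent_vec (mix_diagram t X Y) i = bin_ent t + t * ent_vec X i + (1 - t) * ent_vec Y i"
proof -
  note fin = ProbD(1)[OF assms(3,5)] ProbD(1)[OF assms(4,5)]
  have "finite (set_pmf (mixture t (space_at X i) (space_at Y i)))"
    using fin by (simp add: set_mixture[OF assms(1,2)])
  then have "ent_vec (mix_diagram t X Y) i = entropy (mixture t (space_at X i) (space_at Y i))"
    unfolding ent_vec_def Ent_eq_entropy space_at_mix
    by (simp add: entropy_map_inj[OF inj_sum_encode])
  then show ?thesis
    by (simp add: entropy_mixture[OF assms(1,2) fin] ent_vec_def Ent_eq_entropy)
qed

text \<open>Distributes the tensor product over a mixture with the unit; on the side of the unit its
  single point is dropped and \<open>w\<close> is kept.\<close>

definition mix_distrib :: "nat \<Rightarrow> nat" where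
  "mix_distrib z = (case prod_decode z of (s, w) \<Rightarrow>
     (case sum_decode s of Inl x \<Rightarrow> sum_encode (Inl (prod_encode (x, w))) | Inr _ \<Rightarrow> sum_encode (Inr w)))"

text \<open>Since \<open>w\<close> is independent of the tag, the tag may be drawn first on both
  sides; the two laws are then binds over the same Bernoulli variable.\<close>

lemma mix_distrib_morphism:
  assumes "0 < t" "t < 1"
  shows "diagram_morphism G (tensor (mix_diagram t X unit_diagram) W)
    (mix_diagram t (tensor X W) W) (\<lambda>_. mix_distrib)"
proof (rule diagram_morphismI)
  fix i
  let ?p = "space_at X i" and ?q = "space_at W i"
  have "map_pmf mix_distrib (space_at (tensor (mix_diagram t X unit_diagram) W) i) =
      bernoulli_pmf t \<bind> (\<lambda>b. if b
        then map_pmf (\<lambda>(x, w). sum_encode (Inl (prod_encode (x, w)))) (pair_pmf ?p ?q)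
        else map_pmf (\<lambda>w. sum_encode (Inr w)) ?q)"
    unfolding space_at_tensor space_at_mix mixture_def pair_pmf_def map_bind_pmf bind_map_pmf bind_assoc_pmf
    by (intro bind_pmf_cong refl)
      (simp add: bind_map_pmf map_bind_pmf mix_distrib_def unit_diagram_def bind_return_pmf map_pmf_def[symmetric])
  also have "\<dots> = space_at (mix_diagram t (tensor X W) W) i"
    unfolding space_at_tensor space_at_mix map_mixture
    by (intro bind_pmf_cong refl) (simp add: map_pmf_comp case_prod_unfold comp_def)
  finally show "map_pmf mix_distrib (space_at (tensor (mix_diagram t X unit_diagram) W) i) =
    space_at (mix_diagram t (tensor X W) W) i" .
qed (auto simp: space_at_tensor space_at_mix red_at_tensor red_at_mix mix_distrib_def
    set_mixture[OF assms] unit_diagram_def)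

section \<open>The intrinsic entropy distance\<close>

lemma kd_nonneg: "0 \<le> kd G X Z Y"
  by (simp add: kd_def l1_norm_def sum_nonneg)

lemma two_fan_exists:
  assumes X: "X \<in> Prob G" and Y: "Y \<in> Prob G"
  obtains Z a b where "two_fan G X Z Y a b"
  using coupled_in_Prob[OF X Y coupling_pair[OF X Y]]
    coupled_morphism_fst[OF coupling_pair[OF X Y]] coupled_morphism_snd[OF coupling_pair[OF X Y]]
  unfolding two_fan_def by blast

lemma kdist_le:
  assumes "two_fan G X Z Y a b"
  shows "kdist G X Y \<le> kd G X Z Y"
  unfolding kdist_def
proof (rule cInf_lower)
  show "kd G X Z Y \<in> {kd G X Z Y | Z a b. two_fan G X Z Y a b}" using assms by blast
  show "bdd_below {kd G X Z Y | Z a b. two_fan G X Z Y a b}"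
    by (rule bdd_belowI[of _ 0]) (auto simp: kd_nonneg)
qed

lemma kd_set_nonempty:
  assumes "X \<in> Prob G" "Y \<in> Prob G"
  shows "{kd G X Z Y | Z a b. two_fan G X Z Y a b} \<noteq> {}"
proof -
  obtain Z a b where "two_fan G X Z Y a b"
    by (rule two_fan_exists[OF assms])
  then have "kd G X Z Y \<in> {kd G X Z Y | Z a b. two_fan G X Z Y a b}" by blast
  then show ?thesis by (metis empty_iff)
qed

lemma kdist_approx:
  assumes "X \<in> Prob G" "Y \<in> Prob G" "0 < e"
  obtains Z a b where "two_fan G X Z Y a b" "kd G X Z Y < kdist G X Y + e"
proof -
  have "Inf {kd G X Z Y | Z a b. two_fan G X Z Y a b} < kdist G X Y + e"
    using \<open>0 < e\<close> by (simp add: kdist_def)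
  from cInf_lessD[OF kd_set_nonempty[OF assms(1,2)] this]
  obtain c where c: "c \<in> {kd G X Z Y | Z a b. two_fan G X Z Y a b}" "c < kdist G X Y + e"
    by (elim bexE)
  from c(1) obtain Z a b where "c = kd G X Z Y" "two_fan G X Z Y a b"
    unfolding mem_Collect_eq by (elim exE conjE)
  then show ?thesis using that[of Z a b] c(2) by simp
qed

lemma kdist_nonneg:
  assumes "X \<in> Prob G" "Y \<in> Prob G"
  shows "0 \<le> kdist G X Y"
  unfolding kdist_def
  by (rule cInf_greatest[OF kd_set_nonempty[OF assms]]) (auto simp: kd_nonneg)

lemma kdist_commute: "kdist G X Y = kdist G Y X"
proof -
  have "kd G X Z Y = kd G Y Z X" for Z by (simp add: kd_def)
  moreover have "two_fan G X Z Y a b \<longleftrightarrow> two_fan G Y Z X b a" for Z a b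
    by (auto simp: two_fan_def)
  ultimately have "{kd G X Z Y | Z a b. two_fan G X Z Y a b} = {kd G Y Z X | Z a b. two_fan G Y Z X a b}"
    by (intro Collect_cong) metis
  then show ?thesis by (simp add: kdist_def)
qed

text \<open>The fan with apex \<open>X\<close> and an identity leg has size equal to the entropy
  gap. In this way each monoid law is settled by a single map that preserves entropies.\<close>

lemma kdist_morphism:
  assumes X: "X \<in> Prob G" and Y: "Y \<in> Prob G" and a: "diagram_morphism G X Y a"
    and ent: "\<And>i. i \<in> Field G \<Longrightarrow> ent_vec X i = ent_vec Y i"
  shows "kdist G X Y = 0"
proof -
  have "two_fan G X X Y (\<lambda>_. id) a"
    using X a diagram_morphism_id by (simp add: two_fan_def)
  then have "kdist G X Y \<le> kd G X X Y" by (rule kdist_le)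
  also have "\<dots> = 0" using ent by (simp add: kd_def l1_norm_def)
  finally show ?thesis using kdist_nonneg[OF X Y] by simp
qed

lemma kd_tensor_le:
  assumes "X \<in> Prob G" "Y \<in> Prob G" "X' \<in> Prob G" "Y' \<in> Prob G" "Z \<in> Prob G" "W \<in> Prob G"
  shows "kd G (tensor X Y) (tensor Z W) (tensor X' Y') \<le> kd G X Z X' + kd G Y W Y'"
  unfolding kd_def l1_norm_def sum.distrib[symmetric]
proof (rule sum_mono)
  fix i assume "i \<in> Field G"
  note ent = ent_vec_tensor[OF _ _ this]
  show "\<bar>ent_vec (tensor Z W) i - ent_vec (tensor X Y) i\<bar> + \<bar>ent_vec (tensor Z W) i - ent_vec (tensor X' Y') i\<bar>
    \<le> \<bar>ent_vec Z i - ent_vec X i\<bar> + \<bar>ent_vec Z i - ent_vec X' i\<bar> +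
      (\<bar>ent_vec W i - ent_vec Y i\<bar> + \<bar>ent_vec W i - ent_vec Y' i\<bar>)"
    using add_mono[OF abs_diff_triangle_ineq abs_diff_triangle_ineq,
        of "ent_vec Z i" "ent_vec W i" "ent_vec X i" "ent_vec Y i" "ent_vec Z i" "ent_vec W i" "ent_vec X' i" "ent_vec Y' i"]
    unfolding ent[OF assms(1,2)] ent[OF assms(3,4)] ent[OF assms(5,6)] by simp
qed

text \<open>Nearly optimal fans are tensored, and entropies add.\<close>

lemma kdist_tensor_le:
  assumes P: "X \<in> Prob G" "Y \<in> Prob G" "X' \<in> Prob G" "Y' \<in> Prob G"
  shows "kdist G (tensor X Y) (tensor X' Y') \<le> kdist G X X' + kdist G Y Y'"
proof (rule field_le_epsilon)
  fix e :: real assume "0 < e"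
  then have e: "0 < e / 2" by simp
  obtain Z a b where Z: "two_fan G X Z X' a b" "kd G X Z X' < kdist G X X' + e / 2"
    using kdist_approx[OF P(1,3) e] by blast
  obtain W c h where W: "two_fan G Y W Y' c h" "kd G Y W Y' < kdist G Y Y' + e / 2"
    using kdist_approx[OF P(2,4) e] by blast
  have ZW: "Z \<in> Prob G" "W \<in> Prob G" using Z(1) W(1) by (auto simp: two_fan_def)
  have "two_fan G (tensor X Y) (tensor Z W) (tensor X' Y')
      (\<lambda>i z. prod_encode (map_prod (a i) (c i) (prod_decode z)))
      (\<lambda>i z. prod_encode (map_prod (b i) (h i) (prod_decode z)))"
    using Z(1) W(1) by (auto simp: two_fan_def tensor_in_Prob tensor_morphism)
  then have "kdist G (tensor X Y) (tensor X' Y') \<le> kd G (tensor X Y) (tensor Z W) (tensor X' Y')"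
    by (rule kdist_le)
  also have "\<dots> \<le> kd G X Z X' + kd G Y W Y'" by (rule kd_tensor_le[OF P ZW])
  finally show "kdist G (tensor X Y) (tensor X' Y') \<le> kdist G X X' + kdist G Y Y' + e"
    using Z(2) W(2) by simp
qed

text \<open>Lower bounds of pairs are iterated over the finitely many objects. The definition admits
  an empty category, hence the second assumption.\<close>

lemma indexing_category_initial:
  assumes G: "indexing_category G" and "Field G \<noteq> {}"
  obtains r where "r \<in> Field G" "\<And>i. i \<in> Field G \<Longrightarrow> (r, i) \<in> G"
proof -
  have fin: "finite (Field G)" and tr: "trans G"
    using G by (simp_all add: indexing_category_def partial_order_on_def preorder_on_def)
  have lb: "\<exists>k\<in>Field G. (k, i) \<in> G \<and> (k, j) \<in> G" if "i \<in> Field G" "j \<in> Field G" for i j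
    using G that unfolding indexing_category_def by blast
  have "\<exists>k\<in>Field G. \<forall>i\<in>S. (k, i) \<in> G" if "finite S" "S \<subseteq> Field G" for S
    using that
  proof (induction S)
    case empty
    then show ?case using \<open>Field G \<noteq> {}\<close> by auto
  next
    case (insert s S)
    then obtain k where k: "k \<in> Field G" "\<And>i. i \<in> S \<Longrightarrow> (k, i) \<in> G" by blast
    obtain l where l: "l \<in> Field G" "(l, k) \<in> G" "(l, s) \<in> G" using lb[of k s] k insert.prems by auto
    then show ?case using k transD[OF tr l(2)] by blast
  qed
  from this[OF fin] show ?thesis using that by blast
qed

text \<open>Any coupling of \<open>Z\<close> and \<open>W\<close> over \<open>Y\<close> at the initial object spreads to the whole diagram as the
  family of its images. The entropy bound needs only that each of these is a coupling over \<open>Y\<close>; the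
  levelwise conditionally independent couplings would not be compatible with the reductions.\<close>

lemma coupling_over:
  assumes G: "indexing_category G"
    and Z: "Z \<in> Prob G" and W: "W \<in> Prob G" and Y: "Y \<in> Prob G"
    and b: "diagram_morphism G Z Y b" and a: "diagram_morphism G W Y a"
  obtains c where "coupling G Z W c"
    "\<And>i. i \<in> Field G \<Longrightarrow> entropy (c i) + ent_vec Y i \<le> ent_vec Z i + ent_vec W i"
proof (cases "Field G = {}")
  case True
  then have "coupling G Z W c" for c
    by (auto simp: coupling_def Field_def)
  then show ?thesis using that True by blast
next
  case False
  obtain r where r: "r \<in> Field G" and ri: "\<And>i. i \<in> Field G \<Longrightarrow> (r, i) \<in> G"
    using indexing_category_initial[OF G False] by blast
  \<comment> \<open>Composition of relators supplies the gluing at \<open>r\<close>: the graph of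
    \<open>b r\<close> followed by the converse graph of \<open>a r\<close> yields a joint law on
    pairs with equal image in \<open>Y\<close>.\<close>
  have "rel_pmf (\<lambda>z y. b r z = y) (space_at Z r) (space_at Y r)"
    unfolding diagram_morphismD(1)[OF b r, symmetric] by (simp add: pmf.rel_map pmf.rel_refl)
  moreover have "rel_pmf (\<lambda>y w. y = a r w) (space_at Y r) (space_at W r)"
    unfolding diagram_morphismD(1)[OF a r, symmetric] by (simp add: pmf.rel_map pmf.rel_refl)
  ultimately have "rel_pmf ((\<lambda>z y. b r z = y) OO (\<lambda>y w. y = a r w)) (space_at Z r) (space_at W r)"
    by (auto simp: pmf.rel_compp)
  then obtain c0 where c0: "\<And>z w. (z, w) \<in> set_pmf c0 \<Longrightarrow> b r z = a r w"
    "map_pmf fst c0 = space_at Z r" "map_pmf snd c0 = space_at W r"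
    by (auto elim!: rel_pmf.cases simp: OO_def)
  have in_set: "z \<in> set_pmf (space_at Z r)" "w \<in> set_pmf (space_at W r)" if "(z, w) \<in> set_pmf c0" for z w
    using that by (force simp flip: c0(2,3))+
  define c where "c = (\<lambda>i. map_pmf (map_prod (red_at Z r i) (red_at W r i)) c0)"
  have c: "coupling G Z W c"
    unfolding coupling_def
  proof (intro conjI ballI)
    fix i assume i: "i \<in> Field G"
    have "map_pmf fst (c i) = map_pmf (red_at Z r i) (map_pmf fst c0)"
      by (simp add: c_def map_pmf_comp)
    then show "map_pmf fst (c i) = space_at Z i" using c0(2) ProbD(2)[OF Z ri[OF i]] by simp
    have "map_pmf snd (c i) = map_pmf (red_at W r i) (map_pmf snd c0)"
      by (simp add: c_def map_pmf_comp)
    then show "map_pmf snd (c i) = space_at W i" using c0(3) ProbD(2)[OF W ri[OF i]] by simp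
  next
    fix ij assume ij: "ij \<in> G"
    obtain i j where [simp]: "ij = (i, j)" by (cases ij)
    have G': "(r, i) \<in> G" "(i, j) \<in> G" using ij ri[OF FieldI1] by auto
    have "map_pmf (map_prod (red_at Z i j) (red_at W i j)) (c i) = c j"
      unfolding c_def map_pmf_comp
      by (rule map_pmf_cong) (use ProbD(4)[OF Z G'] ProbD(4)[OF W G'] in_set in auto)
    then show "case ij of (i, j) \<Rightarrow> map_pmf (map_prod (red_at Z i j) (red_at W i j)) (c i) = c j" by simp
  qed
  moreover have "entropy (c i) + ent_vec Y i \<le> ent_vec Z i + ent_vec W i" if i: "i \<in> Field G" for i
  proof -
    \<comment> \<open>Naturality of the two morphisms carries the equality of images from
      \<open>r\<close> to \<open>i\<close>.\<close>
    have "b i z = a i w" if zw: "(z, w) \<in> set_pmf (c i)" for z w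
    proof -
      obtain z0 w0 where 0: "(z0, w0) \<in> set_pmf c0" "z = red_at Z r i z0" "w = red_at W r i w0"
        using zw by (auto simp: c_def)
      show ?thesis
        using diagram_morphismD(2)[OF b ri[OF i] in_set(1)[OF 0(1)]]
          diagram_morphismD(2)[OF a ri[OF i] in_set(2)[OF 0(1)]] c0(1)[OF 0(1)] 0 by simp
    qed
    then have "entropy (c i) + entropy (map_pmf (b i \<circ> fst) (c i)) \<le>
        entropy (map_pmf fst (c i)) + entropy (map_pmf snd (c i))"
      by (intro entropy_submodular finite_coupling[OF Z W c i]) blast
    moreover have "map_pmf (b i \<circ> fst) (c i) = space_at Y i"
      using diagram_morphismD(1)[OF b i] coupling_fst[OF c i] by (simp add: map_pmf_compose)
    ultimately show ?thesis
      using coupling_fst[OF c i] coupling_snd[OF c i] by (simp add: ent_vec_def Ent_eq_entropy)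
  qed
  ultimately show ?thesis by (rule that)
qed

text \<open>Nearly optimal fans are glued over the middle diagram \<open>Y\<close>. Entropy does not
  increase along morphisms, so the gaps open without absolute values, and at each object the bound
  becomes twice the submodularity inequality.\<close>

lemma kdist_triangle:
  assumes G: "indexing_category G" and P: "X \<in> Prob G" "Y \<in> Prob G" "V \<in> Prob G"
  shows "kdist G X V \<le> kdist G X Y + kdist G Y V"
proof (rule field_le_epsilon)
  fix e :: real assume "0 < e"
  then have e: "0 < e / 2" by simp
  obtain Z a b where Z: "two_fan G X Z Y a b" "kd G X Z Y < kdist G X Y + e / 2"
    using kdist_approx[OF P(1,2) e] by blast
  obtain W a' b' where W: "two_fan G Y W V a' b'" "kd G Y W V < kdist G Y V + e / 2"
    using kdist_approx[OF P(2,3) e] by blast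
  have ZP: "Z \<in> Prob G" and WP: "W \<in> Prob G"
    and m: "diagram_morphism G Z X a" "diagram_morphism G Z Y b"
      "diagram_morphism G W Y a'" "diagram_morphism G W V b'"
    using Z(1) W(1) by (auto simp: two_fan_def)
  obtain c where c: "coupling G Z W c"
    and ent: "\<And>i. i \<in> Field G \<Longrightarrow> entropy (c i) + ent_vec Y i \<le> ent_vec Z i + ent_vec W i"
    using coupling_over[OF G ZP WP P(2) m(2,3)] by blast
  let ?U = "coupled Z W c"
  have UP: "?U \<in> Prob G" by (rule coupled_in_Prob[OF ZP WP c])
  note f = coupled_morphism_fst[OF c] and s = coupled_morphism_snd[OF c]
  have "kdist G X V \<le> kd G X ?U V"
    using diagram_morphism_comp[OF f m(1)] diagram_morphism_comp[OF s m(4)] UP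
    by (intro kdist_le) (simp add: two_fan_def)
  also have "\<dots> \<le> kd G X Z Y + kd G Y W V"
    unfolding kd_def l1_norm_def sum.distrib[symmetric]
  proof (rule sum_mono)
    fix i assume i: "i \<in> Field G"
    have "ent_vec ?U i + ent_vec Y i \<le> ent_vec Z i + ent_vec W i"
      using ent[OF i] ent_vec_coupled[OF ZP WP c i] by simp
    then show "\<bar>ent_vec ?U i - ent_vec X i\<bar> + \<bar>ent_vec ?U i - ent_vec V i\<bar>
      \<le> \<bar>ent_vec Z i - ent_vec X i\<bar> + \<bar>ent_vec Z i - ent_vec Y i\<bar> +
        (\<bar>ent_vec W i - ent_vec Y i\<bar> + \<bar>ent_vec W i - ent_vec V i\<bar>)"
      using ent_vec_morphism_le[OF ZP m(1) i] ent_vec_morphism_le[OF WP m(4) i]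
        ent_vec_morphism_le[OF UP f i] ent_vec_morphism_le[OF UP s i] by linarith
  qed
  finally show "kdist G X V \<le> kdist G X Y + kdist G Y V + e"
    using Z(2) W(2) by simp
qed

section \<open>The monoid laws and the mixing axiom for \<open>kdist\<close>\<close>

lemma kdist_tensor_commute:
  assumes P: "X \<in> Prob G" "Y \<in> Prob G"
  shows "kdist G (tensor X Y) (tensor Y X) = 0"
proof (rule kdist_morphism)
  show "diagram_morphism G (tensor X Y) (tensor Y X) (\<lambda>_ z. prod_encode (prod.swap (prod_decode z)))"
  proof (rule diagram_morphismI)
    fix i
    show "map_pmf (\<lambda>z. prod_encode (prod.swap (prod_decode z))) (space_at (tensor X Y) i) = space_at (tensor Y X) i"
      unfolding space_at_tensor by (subst (2) pair_commute_pmf)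
        (simp add: map_pmf_comp prod.swap_def case_prod_unfold)
  qed (auto simp: space_at_tensor red_at_tensor)
qed (simp_all add: P tensor_in_Prob ent_vec_tensor[where G = G])

definition reassociate :: "nat \<Rightarrow> nat" where
  "reassociate z = (case prod_decode z of (s, w) \<Rightarrow>
     (case prod_decode s of (x, y) \<Rightarrow> prod_encode (x, prod_encode (y, w))))"

lemma kdist_tensor_assoc:
  assumes P: "X \<in> Prob G" "Y \<in> Prob G" "W \<in> Prob G"
  shows "kdist G (tensor (tensor X Y) W) (tensor X (tensor Y W)) = 0"
proof (rule kdist_morphism)
  show "diagram_morphism G (tensor (tensor X Y) W) (tensor X (tensor Y W)) (\<lambda>_. reassociate)"
  proof (rule diagram_morphismI)
    fix i
    show "map_pmf reassociate (space_at (tensor (tensor X Y) W) i) = space_at (tensor X (tensor Y W)) i"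
      unfolding space_at_tensor pair_pmf_def map_bind_pmf bind_map_pmf bind_assoc_pmf
      by (simp add: bind_return_pmf bind_assoc_pmf bind_map_pmf reassociate_def)
  qed (auto simp: space_at_tensor red_at_tensor reassociate_def)
qed (simp_all add: P tensor_in_Prob ent_vec_tensor[where G = G])

lemma kdist_tensor_unit:
  assumes P: "X \<in> Prob G"
  shows "kdist G (tensor unit_diagram X) X = 0"
proof (rule kdist_morphism)
  show "diagram_morphism G (tensor unit_diagram X) X (\<lambda>_. snd \<circ> prod_decode)"
    unfolding tensor_eq_coupled
    by (intro coupled_morphism_snd coupling_pair P unit_diagram_in_Prob)
qed (simp_all add: P tensor_in_Prob ent_vec_tensor[where G = G] unit_diagram_in_Prob ent_vec_unit)

text \<open>Nearly optimal fans to \<open>V\<close> are mixed. The leg to the mixture of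
  \<open>X\<close> and \<open>Y\<close> keeps the tag, so there the entropy gaps average exactly;
  the leg to \<open>V\<close> forgets it, which adds at most \<open>bin_ent t\<close> at every
  object.\<close>

lemma kdist_mix_le:
  assumes t: "0 < t" "t < 1" and P: "X \<in> Prob G" "Y \<in> Prob G" "V \<in> Prob G"
  shows "kdist G (mix_diagram t X Y) V \<le>
    real (card (Field G)) * bin_ent t + t * kdist G X V + (1 - t) * kdist G Y V"
proof (rule field_le_epsilon)
  fix e :: real assume e: "0 < e"
  \<comment> \<open>The same \<open>e\<close> serves both fans, because the weights \<open>t\<close>
    and \<open>1 - t\<close> average the two errors.\<close>
  obtain Z a b where Z: "two_fan G X Z V a b" "kd G X Z V < kdist G X V + e"
    using kdist_approx[OF P(1,3) e] by blast
  obtain W a' b' where W: "two_fan G Y W V a' b'" "kd G Y W V < kdist G Y V + e"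
    using kdist_approx[OF P(2,3) e] by blast
  have ZP: "Z \<in> Prob G" and WP: "W \<in> Prob G"
    and m: "diagram_morphism G Z X a" "diagram_morphism G Z V b"
      "diagram_morphism G W Y a'" "diagram_morphism G W V b'"
    using Z(1) W(1) by (auto simp: two_fan_def)
  have h: "0 \<le> bin_ent t"
    using mult_nonneg_nonpos[of t "ln t"] mult_nonneg_nonpos[of "1 - t" "ln (1 - t)"] t
    by (simp add: bin_ent_def)
  let ?U = "mix_diagram t Z W"
  have "kdist G (mix_diagram t X Y) V \<le> kd G (mix_diagram t X Y) ?U V"
    using mix_diagram_morphism[OF t m(1,3)] mix_diagram_fold_morphism[OF t m(2,4)]
      mix_diagram_in_Prob[OF t ZP WP]
    by (intro kdist_le) (simp add: two_fan_def)
  also have "\<dots> \<le> (\<Sum>i\<in>Field G. bin_ent t +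
      t * (\<bar>ent_vec Z i - ent_vec X i\<bar> + \<bar>ent_vec Z i - ent_vec V i\<bar>) +
      (1 - t) * (\<bar>ent_vec W i - ent_vec Y i\<bar> + \<bar>ent_vec W i - ent_vec V i\<bar>))"
    unfolding kd_def l1_norm_def sum.distrib[symmetric]
  proof (rule sum_mono)
    fix i assume i: "i \<in> Field G"
    have tri: "\<bar>t * x + (1 - t) * y\<bar> \<le> t * \<bar>x\<bar> + (1 - t) * \<bar>y\<bar>" for x y
      using abs_triangle_ineq[of "t * x" "(1 - t) * y"] t by (simp add: abs_mult)
    have "ent_vec ?U i - ent_vec (mix_diagram t X Y) i =
        t * (ent_vec Z i - ent_vec X i) + (1 - t) * (ent_vec W i - ent_vec Y i)"
      by (simp add: ent_vec_mix_diagram[OF t _ _ i] ZP WP P algebra_simps)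
    moreover have "ent_vec ?U i - ent_vec V i =
        bin_ent t + (t * (ent_vec Z i - ent_vec V i) + (1 - t) * (ent_vec W i - ent_vec V i))"
      by (simp add: ent_vec_mix_diagram[OF t _ _ i] ZP WP P algebra_simps)
    ultimately show "\<bar>ent_vec ?U i - ent_vec (mix_diagram t X Y) i\<bar> + \<bar>ent_vec ?U i - ent_vec V i\<bar> \<le>
        bin_ent t + t * (\<bar>ent_vec Z i - ent_vec X i\<bar> + \<bar>ent_vec Z i - ent_vec V i\<bar>) +
        (1 - t) * (\<bar>ent_vec W i - ent_vec Y i\<bar> + \<bar>ent_vec W i - ent_vec V i\<bar>)"
      using tri[of "ent_vec Z i - ent_vec X i" "ent_vec W i - ent_vec Y i"]
        tri[of "ent_vec Z i - ent_vec V i" "ent_vec W i - ent_vec V i"]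
        abs_triangle_ineq[of "bin_ent t" "t * (ent_vec Z i - ent_vec V i) + (1 - t) * (ent_vec W i - ent_vec V i)"] h
      by (simp add: distrib_left)
  qed
  also have "\<dots> = real (card (Field G)) * bin_ent t + t * kd G X Z V + (1 - t) * kd G Y W V"
    unfolding kd_def l1_norm_def by (simp add: sum.distrib sum_distrib_left[symmetric])
  also have "t * kd G X Z V \<le> t * (kdist G X V + e)"
    using Z(2) t by (intro mult_left_mono) auto
  also have "(1 - t) * kd G Y W V \<le> (1 - t) * (kdist G Y V + e)"
    using W(2) t by (intro mult_left_mono) auto
  finally show "kdist G (mix_diagram t X Y) V \<le>
      real (card (Field G)) * bin_ent t + t * kdist G X V + (1 - t) * kdist G Y V + e"
    by (simp add: algebra_simps)
qed

lemma kdist_mix_distrib: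
  assumes t: "0 < t" "t < 1" and P: "X \<in> Prob G" "W \<in> Prob G"
  shows "kdist G (tensor (mix_diagram t X unit_diagram) W) (mix_diagram t (tensor X W) W) = 0"
  by (rule kdist_morphism[OF _ _ mix_distrib_morphism[OF t]])
    (simp_all add: tensor_in_Prob mix_diagram_in_Prob unit_diagram_in_Prob P t
      ent_vec_tensor[where G = G] ent_vec_mix_diagram[where G = G] ent_vec_unit algebra_simps)

text \<open>The constant is the number of objects, since the mixing variable is paid for once at
  each of them.\<close>

lemma kdist_mixing_metric_monoid:
  assumes G: "indexing_category G"
  shows "mixing_metric_monoid (Prob G) tensor unit_diagram (kdist G) (real (card (Field G)))"
proof
  show "kdist G x y = kdist G y x" for x y :: "'a diagram"
    by (rule kdist_commute)
  show "kdist G x x = 0" if "x \<in> Prob G" for x :: "'a diagram"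
    by (rule kdist_morphism[OF that that diagram_morphism_id]) simp
  fix x :: "'a diagram" and a :: real assume x: "x \<in> Prob G" and a: "0 < a" "a < 1"
  show "\<exists>z\<in>Prob G. \<forall>w\<in>Prob G. \<forall>y\<in>Prob G. kdist G (tensor z w) y \<le>
      real (card (Field G)) * bin_ent a + a * kdist G (tensor x w) y + (1 - a) * kdist G w y"
  proof (intro bexI ballI)
    let ?z = "mix_diagram a x unit_diagram"
    show z: "?z \<in> Prob G" by (intro mix_diagram_in_Prob a x unit_diagram_in_Prob)
    fix w y :: "'a diagram" assume wy: "w \<in> Prob G" "y \<in> Prob G"
    have "kdist G (tensor ?z w) y \<le>
        kdist G (tensor ?z w) (mix_diagram a (tensor x w) w) + kdist G (mix_diagram a (tensor x w) w) y"
      by (intro kdist_triangle[OF G] tensor_in_Prob mix_diagram_in_Prob a x z wy)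
    also have "\<dots> \<le> real (card (Field G)) * bin_ent a + a * kdist G (tensor x w) y + (1 - a) * kdist G w y"
      using kdist_mix_distrib[OF a x wy(1)] kdist_mix_le[OF a tensor_in_Prob[OF x wy(1)] wy] by simp
    finally show "kdist G (tensor ?z w) y \<le>
      real (card (Field G)) * bin_ent a + a * kdist G (tensor x w) y + (1 - a) * kdist G w y" .
  qed
qed (simp_all add: tensor_in_Prob unit_diagram_in_Prob kdist_nonneg kdist_triangle[OF G]
    kdist_tensor_le kdist_tensor_commute kdist_tensor_assoc kdist_tensor_unit)

section \<open>Admissible functions\<close>

text \<open>Between \<open>s\<close> and \<open>2 * s\<close> the integrand is at least \<phi>(s) /
  (2s)^2 by monotonicity, and the interval has length \<open>s\<close>; this gives the first
  summand.\<close>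

lemma set_integral_halve:
  fixes \<phi> :: "real \<Rightarrow> real"
  assumes mono: "mono_on {1..} \<phi>" and s: "1 \<le> s"
    and int: "set_integrable lborel {s..} (\<lambda>t. \<phi> t / t\<^sup>2)"
    and nonneg: "0 \<le> \<phi> s"
  shows "\<phi> s / (4 * s) + (LINT t:{2 * s..}|lborel. \<phi> t / t\<^sup>2) \<le> (LINT t:{s..}|lborel. \<phi> t / t\<^sup>2)"
proof -
  have i1: "set_integrable lborel {s..<2 * s} (\<lambda>t. \<phi> t / t\<^sup>2)"
    and i2: "set_integrable lborel {2 * s..} (\<lambda>t. \<phi> t / t\<^sup>2)"
    using s by (auto intro!: set_integrable_subset[OF int])
  have "{s..<2 * s} \<union> {2 * s..} = {s..}" using s by auto
  then have split: "(LINT t:{s..}|lborel. \<phi> t / t\<^sup>2) =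
      (LINT t:{s..<2 * s}|lborel. \<phi> t / t\<^sup>2) + (LINT t:{2 * s..}|lborel. \<phi> t / t\<^sup>2)"
    by (subst set_integral_Un[OF _ i1 i2, symmetric]) auto
  have "\<phi> s / (4 * s) = (LINT t:{s..<2 * s}|lborel. \<phi> s / (2 * s)\<^sup>2)"
    using s by (simp add: set_lebesgue_integral_def power2_eq_square)
  also have "\<dots> \<le> (LINT t:{s..<2 * s}|lborel. \<phi> t / t\<^sup>2)"
  proof (rule set_integral_mono[OF _ i1])
    show "set_integrable lborel {s..<2 * s} (\<lambda>t. \<phi> s / (2 * s)\<^sup>2)"
      unfolding set_integrable_def by (intro integrable_scaleR_left integrable_real_indicator) (use s in simp_all)
    fix t assume t: "t \<in> {s..<2 * s}"
    show "\<phi> s / (2 * s)\<^sup>2 \<le> \<phi> t / t\<^sup>2"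
    proof (rule frac_le)
      show "\<phi> s \<le> \<phi> t" using mono_onD[OF mono, of s t] s t by auto
      then show "0 \<le> \<phi> t" using nonneg by simp
      show "0 < t\<^sup>2" using s t by simp
      show "t\<^sup>2 \<le> (2 * s)\<^sup>2" using s t by (intro power_mono) auto
    qed
  qed
  finally show ?thesis unfolding split by simp
qed

text \<open>The tail is cut at the points 2^i s, and each block is compared with one term of the
  dyadic sum. The new constant \<open>D / 2\<close> is \<open>4 * (D / 8)\<close>, with 4 the factor
  lost on a block.\<close>

lemma admissible_dyadic:
  assumes "admissible \<phi>"
  obtains D where "dyadic_admissible (\<lambda>n. \<phi> (real n)) D"
proof -
  obtain D where nonneg: "\<And>t. 1 \<le> t \<Longrightarrow> 0 \<le> \<phi> t" and mono: "mono_on {1..} \<phi>" and D: "0 \<le> D"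
    and int: "\<And>s. 1 \<le> s \<Longrightarrow> set_integrable lborel {s..} (\<lambda>t. \<phi> t / t\<^sup>2)"
    and bound: "\<And>s. 1 \<le> s \<Longrightarrow> s * (LINT t:{s..}|lborel. \<phi> t / t\<^sup>2) \<le> D / 8 * \<phi> s"
    using assms unfolding admissible_def by blast
  define \<tau> where "\<tau> = (\<lambda>s. LINT t:{s..}|lborel. \<phi> t / t\<^sup>2)"
  have halve: "\<phi> s / (4 * s) + \<tau> (2 * s) \<le> \<tau> s" if "1 \<le> s" for s
    unfolding \<tau>_def by (rule set_integral_halve[OF mono that int[OF that] nonneg[OF that]])
  \<comment> \<open>The tail starts at \<open>2 * s\<close> because the sum starts at
    \<open>i = 1\<close>; the induction doubles the base point.\<close>
  have sum: "(\<Sum>i=1..k. \<phi> (2 ^ i * s) / 2 ^ i) \<le> 4 * s * \<tau> (2 * s)" if "1 \<le> s" for k s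
    using that
  proof (induction k arbitrary: s)
    case 0
    have "0 \<le> \<tau> (2 * s)"
      unfolding \<tau>_def set_lebesgue_integral_def using 0 nonneg
      by (intro integral_nonneg_AE AE_I2) (auto simp: indicator_def)
    then show ?case using 0 by simp
  next
    case (Suc k)
    have "(\<Sum>i=1..Suc k. \<phi> (2 ^ i * s) / 2 ^ i) =
        \<phi> (2 * s) / 2 + (\<Sum>i=1..k. \<phi> (2 ^ i * (2 * s)) / 2 ^ i) / 2"
      by (simp add: sum.atLeast1_atMost_eq sum.lessThan_Suc_shift sum_divide_distrib mult_ac del: sum.lessThan_Suc sum.cl_ivl_Suc)
    also have "\<dots> \<le> \<phi> (2 * s) / 2 + 4 * (2 * s) * \<tau> (2 * (2 * s)) / 2"
      using Suc.IH[of "2 * s"] Suc.prems by (intro add_mono divide_right_mono) auto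
    also have "\<phi> (2 * s) / 2 + 4 * (2 * s) * \<tau> (2 * (2 * s)) / 2 =
        4 * s * (\<phi> (2 * s) / (4 * (2 * s)) + \<tau> (2 * (2 * s)))"
      using Suc.prems by (simp add: field_simps)
    also have "\<dots> \<le> 4 * s * \<tau> (2 * s)"
      using halve[of "2 * s"] Suc.prems by (intro mult_left_mono) auto
    finally show ?case .
  qed
  have "dyadic_admissible (\<lambda>n. \<phi> (real n)) (D / 2)"
    unfolding dyadic_admissible_def
  proof (intro conjI allI impI)
    fix m k :: nat assume m: "1 \<le> m"
    have "(\<Sum>i=1..k. \<phi> (real (2 ^ i * m)) / 2 ^ i) \<le> 4 * real m * \<tau> (2 * real m)"
      using sum[of "real m" k] m by simp
    also have "\<dots> \<le> 4 * real m * \<tau> (real m)"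
    proof (rule mult_left_mono)
      have "0 \<le> \<phi> (real m) / (4 * real m)" using nonneg[of "real m"] m by simp
      then show "\<tau> (2 * real m) \<le> \<tau> (real m)" using halve[of "real m"] m by simp
    qed simp
    also have "\<dots> \<le> D / 2 * \<phi> (real m)"
      using bound[of "real m"] m unfolding \<tau>_def by simp
    finally show "(\<Sum>i=1..k. \<phi> (real (2 ^ i * m)) / 2 ^ i) \<le> D / 2 * \<phi> (real m)" .
  next
    fix m n :: nat assume "1 \<le> m \<and> m \<le> n"
    then show "\<phi> (real m) \<le> \<phi> (real n)" by (intro mono_onD[OF mono]) auto
  qed (use nonneg D in auto)
  then show ?thesis by (rule that)
qed

section \<open>Sequences of diagrams\<close>

lemma tensor_power_eq_pow: "tensor_power X n = pow tensor unit_diagram X n"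
  by (induction n) auto

lemma power_seq_eq_pow: "power_seq X = pow tensor unit_diagram X"
  by (simp add: power_seq_def tensor_power_eq_pow fun_eq_iff)

lemma asymp_dist_eq: "asymp_dist = lim_dist"
  by (simp add: asymp_dist_def lim_dist_def fun_eq_iff)

lemma diagram_iso_refl: "diagram_iso G X X"
  unfolding diagram_iso_def by (intro exI[of _ "\<lambda>_. id"]) (simp add: diagram_morphism_id red_eq_iff)

lemma QL_eq: "QL G \<rho> \<phi> =
    {X \<in> qlin (Prob G) tensor \<rho> (\<lambda>n. \<phi> (real n)). diagram_iso G (X 0) unit_diagram}"
  by (auto simp: QL_def quasi_linear_def qlin_def)

lemma Lin_eq: "Lin G \<rho> =
    {X \<in> qlin (Prob G) tensor \<rho> (\<lambda>_. 0). diagram_iso G (X 0) unit_diagram}"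
  by (simp add: Lin_def QL_eq)

text \<open>The constant 0 gives the inclusion whatever the sign of \<phi>.\<close>

lemma qlin_zero_imp_qlin:
  assumes "X \<in> qlin P ten d (\<lambda>_. 0)"
  shows "X \<in> qlin P ten d \<phi>"
proof -
  obtain C :: real where "\<And>m n. 1 \<le> m \<Longrightarrow> 1 \<le> n \<Longrightarrow> d (X (m + n)) (ten (X m) (X n)) \<le> C * 0"
    using assms unfolding qlin_def by auto
  then have "d (X (m + n)) (ten (X m) (X n)) \<le> 0 * \<phi> (m + n)" if "1 \<le> m" "1 \<le> n" for m n
    using that by simp
  then show ?thesis
    using assms unfolding qlin_def by blast
qed

lemma (in metric_monoid) pseudo_metric_space_carrier: "pseudo_metric_space P d"
  unfolding pseudo_metric_space_def using nonneg sym tri by auto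

lemma (in metric_monoid) pseudo_metric_space_qlin:
  assumes "dyadic_admissible \<phi> D" "S \<subseteq> qlin P ten d \<phi>"
  shows "pseudo_metric_space S (lim_dist d)"
  using lim_dist_pseudo_metric[OF assms(1)] assms(2) unfolding pseudo_metric_space_def
  by (meson subset_iff)

lemma isometric_embeddingI:
  assumes "pseudo_metric_space M d" "pseudo_metric_space N e" "\<And>x. x \<in> M \<Longrightarrow> f x \<in> N"
    and "\<And>x y. x \<in> M \<Longrightarrow> y \<in> M \<Longrightarrow> e (f x) (f y) = d x y"
  shows "isometric_embedding M d N e f"
  using assms by (simp add: isometric_embedding_def Pi_I)

lemma isometryI:
  assumes "isometric_embedding M d N e f" "\<And>y. y \<in> N \<Longrightarrow> \<exists>x\<in>M. e (f x) y = 0"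
  shows "isometry M d N e f"
  using assms by (simp add: isometry_def)

theorem theorem4p5:
  fixes G :: "('g \<times> 'g) set" and \<phi> :: "real \<Rightarrow> real"
  assumes "indexing_category G"
    and "admissible \<phi>"
    and "\<forall>t\<ge>1. 0 < \<phi> t"
  defines "P \<equiv> Prob G"
    and "k \<equiv> kdist G"
    and "\<kappa> \<equiv> kappa G"
    and "k_hat \<equiv> asymp_dist (kdist G)"
    and "\<kappa>_hat \<equiv> asymp_dist (kappa G)"
  shows
    "((inclusion \<circ> power_seq :: 'g diagram \<Rightarrow> nat \<Rightarrow> 'g diagram) = power_seq \<and>
      (inclusion \<circ> inclusion :: (nat \<Rightarrow> 'g diagram) \<Rightarrow> nat \<Rightarrow> 'g diagram) = inclusion \<circ> inclusion) \<and>
     (isometry P \<kappa> (Lin G k) k_hat power_seq \<and>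
      isometry P \<kappa> (Lin G \<kappa>) \<kappa>_hat power_seq \<and>
      isometry (Lin G k) k_hat (Lin G \<kappa>) \<kappa>_hat inclusion) \<and>
     (isometric_embedding (QL G k \<phi>) k_hat (QL G \<kappa> \<phi>) \<kappa>_hat inclusion \<and>
      dense_image (QL G k \<phi>) (QL G \<kappa> \<phi>) \<kappa>_hat inclusion \<and>
      isometric_embedding (Lin G k) k_hat (QL G k \<phi>) k_hat inclusion \<and>
      dense_image (Lin G k) (QL G k \<phi>) k_hat inclusion \<and>
      isometric_embedding (Lin G \<kappa>) \<kappa>_hat (QL G \<kappa> \<phi>) \<kappa>_hat inclusion \<and>
      dense_image (Lin G \<kappa>) (QL G \<kappa> \<phi>) \<kappa>_hat inclusion) \<and>
     complete_pseudo_metric (QL G \<kappa> \<phi>) \<kappa>_hat"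
proof -
  let ?g = "real (card (Field G))"
  interpret M: mixing_metric_monoid "Prob G" tensor unit_diagram "kdist G" ?g
    by (rule kdist_mixing_metric_monoid[OF assms(1)])
  \<comment> \<open>An equality of functions, valid off \<open>Prob G\<close> too: both sides are
    limits of the same quotients.\<close>
  have kappa: "kappa G = M.kap"
    by (simp add: fun_eq_iff kappa_def M.kap_def lim_dist_def tensor_power_eq_pow)
  interpret K: metric_monoid "Prob G" tensor unit_diagram M.kap
    by (rule M.kap_metric_monoid)
  define \<psi> where "\<psi> = (\<lambda>n. \<phi> (real n))"
  obtain D where adm: "dyadic_admissible \<psi> D"
    using admissible_dyadic[OF assms(2)] unfolding \<psi>_def by blast
  have g: "0 \<le> ?g" and pos: "0 < \<psi> 1" using assms(3) by (auto simp: \<psi>_def)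
  note adm0 = dyadic_admissible_zero
  \<comment> \<open>A uniform shape for the four spaces of sequences; the isomorphism supplies the
    normalisation at index 0.\<close>
  define Q where "Q = (\<lambda>d \<psi>. {X \<in> qlin (Prob G) tensor d \<psi>. diagram_iso G (X 0) unit_diagram})"
  have QI: "X \<in> Q d \<psi>" if "X \<in> qlin (Prob G) tensor d \<psi>" "X 0 = unit_diagram" for X d \<psi>
    using that by (simp add: Q_def diagram_iso_refl)
  have Q_qlin: "Q d \<psi> \<subseteq> qlin (Prob G) tensor d \<psi>" for d \<psi> by (auto simp: Q_def)
  have sets: "Lin G d = Q d (\<lambda>_. 0)" "QL G d \<phi> = Q d \<psi>" for d
    by (simp_all add: Lin_eq QL_eq Q_def \<psi>_def)
  have Q_kap: "Q (kdist G) \<psi> \<subseteq> Q M.kap \<psi>" for \<psi>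
    using M.qlin_kap by (auto simp: Q_def)
  have Q0: "Q d (\<lambda>_. 0) \<subseteq> Q d \<psi>" for d
    using qlin_zero_imp_qlin by (auto simp: Q_def)
  have pw_k: "power_seq X \<in> Q (kdist G) (\<lambda>_. 0)" and pw_kap: "power_seq X \<in> Q M.kap (\<lambda>_. 0)"
    if "X \<in> Prob G" for X
    using M.pw_in_qlin[OF that] K.pw_in_qlin[OF that]
    by (auto intro!: QI simp: power_seq_eq_pow)
  have ps: "pseudo_metric_space (Q (kdist G) (\<lambda>_. 0)) (lim_dist (kdist G))"
    "pseudo_metric_space (Q (kdist G) \<psi>) (lim_dist (kdist G))"
    "pseudo_metric_space (Q M.kap (\<lambda>_. 0)) (lim_dist M.kap)"
    "pseudo_metric_space (Q M.kap \<psi>) (lim_dist M.kap)"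
    by (rule M.pseudo_metric_space_qlin[OF adm0 Q_qlin] M.pseudo_metric_space_qlin[OF adm Q_qlin]
        K.pseudo_metric_space_qlin[OF adm0 Q_qlin] K.pseudo_metric_space_qlin[OF adm Q_qlin])+
  have eq: "lim_dist M.kap X Y = lim_dist (kdist G) X Y" if "X \<in> Q (kdist G) \<psi>" "Y \<in> Q (kdist G) \<psi>" for X Y
    using M.lim_dist_kap[OF adm] that by (auto simp: Q_def)
  have eq0: "lim_dist M.kap X Y = lim_dist (kdist G) X Y"
    if "X \<in> Q (kdist G) (\<lambda>_. 0)" "Y \<in> Q (kdist G) (\<lambda>_. 0)" for X Y
    using M.lim_dist_kap[OF adm0] that by (auto simp: Q_def)
  have onto: "\<exists>X\<in>Prob G. lim_dist M.kap (power_seq X) Y = 0" if "Y \<in> Q M.kap (\<lambda>_. 0)" for Y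
    using K.lim_dist_linear_pw[of Y] that qlin_closed[of Y _ _ _ _ 1] unfolding Q_def power_seq_eq_pow by blast
  have onto': "\<exists>X\<in>Prob G. lim_dist (kdist G) (power_seq X) Y = 0" if "Y \<in> Q (kdist G) (\<lambda>_. 0)" for Y
    using M.lim_dist_linear_pw[of Y] that qlin_closed[of Y _ _ _ _ 1] unfolding Q_def power_seq_eq_pow by blast
  \<comment> \<open>The common source of the three density statements: the approximating powers lie
    in each of the four spaces, by \<open>pw_k\<close>, \<open>pw_kap\<close> and
    \<open>Q0\<close>.\<close>
  have dense: "\<exists>X\<in>Prob G. lim_dist M.kap (power_seq X) Y < e" if "Y \<in> Q M.kap \<psi>" "0 < e" for Y e
    using M.powers_dense[OF g adm _ that(2), of Y] that(1) unfolding Q_def power_seq_eq_pow by blast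
  \<comment> \<open>Distances are preserved by the definition of \<open>kap\<close>; a linear
    sequence is reached, up to distance 0, from its first term.\<close>
  have "isometry (Prob G) M.kap (Q (kdist G) (\<lambda>_. 0)) (lim_dist (kdist G)) power_seq"
    by (intro isometryI isometric_embeddingI K.pseudo_metric_space_carrier ps pw_k onto')
      (simp_all add: M.kap_def power_seq_eq_pow)
  moreover have "isometry (Prob G) M.kap (Q M.kap (\<lambda>_. 0)) (lim_dist M.kap) power_seq"
    by (intro isometryI isometric_embeddingI K.pseudo_metric_space_carrier ps pw_kap onto)
      (simp_all add: M.lim_dist_kap_pw power_seq_eq_pow)
  moreover have "isometry (Q (kdist G) (\<lambda>_. 0)) (lim_dist (kdist G)) (Q M.kap (\<lambda>_. 0)) (lim_dist M.kap) inclusion"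
    unfolding inclusion_def
  proof (intro isometryI isometric_embeddingI ps eq0 subsetD[OF Q_kap])
    fix Y assume "Y \<in> Q M.kap (\<lambda>_. 0)"
    then obtain X where "X \<in> Prob G" "lim_dist M.kap (power_seq X) Y = 0" using onto by blast
    then show "\<exists>X\<in>Q (kdist G) (\<lambda>_. 0). lim_dist M.kap X Y = 0"
      by (intro bexI[of _ "power_seq X"] pw_k)
  qed
  moreover have "isometric_embedding (Q (kdist G) \<psi>) (lim_dist (kdist G)) (Q M.kap \<psi>) (lim_dist M.kap) inclusion"
    unfolding inclusion_def by (intro isometric_embeddingI ps eq subsetD[OF Q_kap])
  moreover have "dense_image (Q (kdist G) \<psi>) (Q M.kap \<psi>) (lim_dist M.kap) inclusion"
    unfolding dense_image_def inclusion_def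
  proof (intro ballI allI impI)
    fix Y and e :: real assume "Y \<in> Q M.kap \<psi>" "0 < e"
    then obtain X where "X \<in> Prob G" "lim_dist M.kap (power_seq X) Y < e" using dense by blast
    then show "\<exists>X\<in>Q (kdist G) \<psi>. lim_dist M.kap X Y < e"
      by (intro bexI[of _ "power_seq X"] subsetD[OF Q0] pw_k)
  qed
  moreover have "isometric_embedding (Q (kdist G) (\<lambda>_. 0)) (lim_dist (kdist G)) (Q (kdist G) \<psi>) (lim_dist (kdist G)) inclusion"
    unfolding inclusion_def by (intro isometric_embeddingI ps subsetD[OF Q0] refl)
  moreover have "dense_image (Q (kdist G) (\<lambda>_. 0)) (Q (kdist G) \<psi>) (lim_dist (kdist G)) inclusion"
    unfolding dense_image_def inclusion_def
  proof (intro ballI allI impI)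
    fix Y and e :: real assume Y: "Y \<in> Q (kdist G) \<psi>" and e: "0 < e"
    \<comment> \<open>The approximation is found for the asymptotic distance of \<kappa> and
      transferred by \<open>eq\<close>, as both sequences are quasi-linear for the intrinsic
      distance.\<close>
    obtain X where X: "X \<in> Prob G" "lim_dist M.kap (power_seq X) Y < e"
      using dense[of Y e] Y e Q_kap by blast
    then show "\<exists>X\<in>Q (kdist G) (\<lambda>_. 0). lim_dist (kdist G) X Y < e"
      using eq[OF subsetD[OF Q0 pw_k[OF X(1)]] Y] pw_k[OF X(1)] by (intro bexI[of _ "power_seq X"]) simp_all
  qed
  moreover have "isometric_embedding (Q M.kap (\<lambda>_. 0)) (lim_dist M.kap) (Q M.kap \<psi>) (lim_dist M.kap) inclusion"
    unfolding inclusion_def by (intro isometric_embeddingI ps subsetD[OF Q0] refl)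
  moreover have "dense_image (Q M.kap (\<lambda>_. 0)) (Q M.kap \<psi>) (lim_dist M.kap) inclusion"
    unfolding dense_image_def inclusion_def
  proof (intro ballI allI impI)
    fix Y and e :: real assume "Y \<in> Q M.kap \<psi>" "0 < e"
    then obtain X where "X \<in> Prob G" "lim_dist M.kap (power_seq X) Y < e" using dense by blast
    then show "\<exists>X\<in>Q M.kap (\<lambda>_. 0). lim_dist M.kap X Y < e"
      by (intro bexI[of _ "power_seq X"] pw_kap)
  qed
  moreover have "complete_pseudo_metric (Q M.kap \<psi>) (lim_dist M.kap)"
    unfolding complete_pseudo_metric_def
  proof (intro conjI allI impI ps)
    fix S :: "nat \<Rightarrow> nat \<Rightarrow> 'g diagram"
    assume S: "(\<forall>n. S n \<in> Q M.kap \<psi>) \<and>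
      (\<forall>e>0. \<exists>N. \<forall>m\<ge>N. \<forall>n\<ge>N. lim_dist M.kap (S m) (S n) < e)"
    then have Sq: "S n \<in> qlin (Prob G) tensor M.kap \<psi>" for n using Q_qlin by blast
    have SC: "\<exists>N. \<forall>m\<ge>N. \<forall>n\<ge>N. lim_dist M.kap (S m) (S n) < e" if "0 < e" for e
      using S that by (elim conjE allE impE)
    \<comment> \<open>The value of the limit at index 0 is recorded because the normalisation must
      hold for it as well.\<close>
    obtain Y where Y: "Y \<in> qlin (Prob G) tensor M.kap \<psi>" "Y 0 = unit_diagram"
        "(\<lambda>n. lim_dist M.kap (S n) Y) \<longlonglongrightarrow> 0"
      by (rule M.qlin_complete[OF g adm pos Sq SC])
    then show "\<exists>Y\<in>Q M.kap \<psi>. (\<lambda>n. lim_dist M.kap (S n) Y) \<longlonglongrightarrow> 0"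
      using QI by blast
  qed
  ultimately show ?thesis
    unfolding P_def k_def \<kappa>_def k_hat_def \<kappa>_hat_def kappa asymp_dist_eq sets
    by (simp add: fun_eq_iff inclusion_def)
qed

end
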